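(* Let $F:T^*\mathbb{T}^d\to T^*\mathbb{T}^d$ be a twist map without conjugate points and let $\overline{F}:T^*\mathbb{R}^d\to T^*\mathbb{R}^d$ be a lift of $F$. For every integer $N\ge 1$, every $r\in\mathbb{Z}^d$ and every $x\in\mathbb{R}^d$, there is a unique $p\in(\mathbb{R}^d)^*$ such that $\overline{F}^N(x,p)=(x+r,p)$.
   Context: Let $d\ge 1$ and $\mathbb{T}^d=\mathbb{R}^d/\mathbb{Z}^d$. Identify $T^*\mathbb{R}^d$ with $\mathbb{R}^d\times(\mathbb{R}^d)^*$ and $T^*\mathbb{T}^d$ with $\mathbb{T}^d\times(\mathbb{R}^d)^*$. A generating function is a $C^2$ map $S:\mathbb{R}^d\times\mathbb{R}^d\to\mathbb{R}$ such that (i) $S(x+r,y+r)=S(x,y)$ for all $x,y\in\mathbb{R}^d$ and $r\in\mathbb{Z}^d$; (ii) there is $A>0$ with $\sum_{i,j}\frac{\partial^2 S}{\partial x_i\partial y_j}(x,y)\,\xi_i\xi_j\le -A\|\xi\|^2$ for all $x,y,\xi\in\mathbb{R}^d$. Write $\partial_1S,\partial_2S$ for the partial differentials in the first and second variable. Condition (ii) implies that $x\mapsto\partial_2S(x,y_0)$ and $y\mapsto\partial_1S(x_0,y)$ are diffeomorphisms from $\mathbb{R}^d$ onto $(\mathbb{R}^d)^*$ for all $x_0,y_0$. Such an $S$ defines a symplectic diffeomorphism of $\mathbb{R}^d\times(\mathbb{R}^d)^*$ by $(x,p)\mapsto(x',p')$ if and only if $p=-\partial_1S(x,x')$ and $p'=\partial_2S(x,x')$.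 By (i) it commutes with the translations $(x,p)\mapsto(x+s,p)$, $s\in\mathbb{Z}^d$, and so induces a symplectic diffeomorphism $F$ of $T^*\mathbb{T}^d$. A twist map is a diffeomorphism $F$ of $T^*\mathbb{T}^d$ obtained in this way. Let $\pi:T^*\mathbb{T}^d\to\mathbb{T}^d$ be the canonical projection and $V(x,p)=\ker\big(D\pi|_{T_{(x,p)}T^*\mathbb{T}^d}\big)$. $F$ is without conjugate points if for all $(x,p)\in T^*\mathbb{T}^d$ and all $n\in\mathbb{Z}\setminus\{0\}$, $V(F^n(x,p))\cap DF^n(x,p)\cdot V(x,p)=\{0\}$. *)

theory Defs
  imports "HOL-Analysis.Analysis"
begin

type_synonym 'd dual = "(real^'d) \<Rightarrow>\<^sub>L real"

text \<open>\<open>'d cotan\<close> is the cotangent bundle of \<open>real^'d\<close>; by translation it is also the tangent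
  space of that bundle, and of the cotangent bundle of the torus, at every point.\<close>

type_synonym 'd cotan = "(real^'d) \<times> 'd dual"

definition int_lattice :: "(real^'d) set" where
  "int_lattice = {r. \<forall>i. r $ i \<in> \<int>}"

definition lattice_rel :: "real^'d \<Rightarrow> real^'d \<Rightarrow> bool" where
  "lattice_rel x y \<longleftrightarrow> x - y \<in> int_lattice"

quotient_type 'd torus = "real^'d" / lattice_rel
  morphisms rep_torus torus_proj
proof (rule equivpI)
  show "reflp (lattice_rel :: real^'d \<Rightarrow> _)"
    by (simp add: reflp_def lattice_rel_def int_lattice_def)
  show "symp (lattice_rel :: real^'d \<Rightarrow> _)"
    unfolding symp_def lattice_rel_def int_lattice_def
    by (auto, metis Ints_minus minus_diff_eq)
  show "transp (lattice_rel :: real^'d \<Rightarrow> _)"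
    unfolding transp_def lattice_rel_def int_lattice_def
    by (auto, metis Ints_add diff_add_cancel add_diff_eq)
qed

type_synonym 'd cotan_torus = "'d torus \<times> 'd dual"

definition cotan_proj :: "('d::finite) cotan \<Rightarrow> 'd cotan_torus" where
  "cotan_proj z = (torus_proj (fst z), snd z)"

definition C2 :: "('a::real_normed_vector \<Rightarrow> real) \<Rightarrow> bool" where
  "C2 f \<longleftrightarrow>
    (\<exists>(f' :: 'a \<Rightarrow> 'a \<Rightarrow>\<^sub>L real) (f'' :: 'a \<Rightarrow> 'a \<Rightarrow>\<^sub>L 'a \<Rightarrow>\<^sub>L real).
      (\<forall>z. (f has_derivative blinfun_apply (f' z)) (at z)) \<and>
      (\<forall>z. (f' has_derivative blinfun_apply (f'' z)) (at z)) \<and>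
      continuous_on UNIV f'')"

definition D1 :: "(real^'d \<Rightarrow> real^'d \<Rightarrow> real) \<Rightarrow> real^'d \<Rightarrow> real^'d \<Rightarrow> 'd dual" where
  "D1 S x y = Blinfun (frechet_derivative (\<lambda>u. S u y) (at x))"

definition D2 :: "(real^'d \<Rightarrow> real^'d \<Rightarrow> real) \<Rightarrow> real^'d \<Rightarrow> real^'d \<Rightarrow> 'd dual" where
  "D2 S x y = Blinfun (frechet_derivative (\<lambda>v. S x v) (at y))"

definition partial_deriv :: "'d \<Rightarrow> (real^'d \<Rightarrow> real) \<Rightarrow> real^'d \<Rightarrow> real" where
  "partial_deriv i f x = frechet_derivative f (at x) (axis i 1)"

definition mixed_partial ::
    "'d \<Rightarrow> 'd \<Rightarrow> (real^'d \<Rightarrow> real^'d \<Rightarrow> real) \<Rightarrow> real^'d \<Rightarrow> real^'d \<Rightarrow> real" where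
  "mixed_partial i j S x y = partial_deriv i (\<lambda>u. partial_deriv j (\<lambda>v. S u v) y) x"

definition generating_function :: "(real^'d \<Rightarrow> real^'d \<Rightarrow> real) \<Rightarrow> bool" where
  "generating_function S \<longleftrightarrow>
    C2 (\<lambda>(x, y). S x y) \<and>
    (\<forall>x y. \<forall>r\<in>int_lattice. S (x + r) (y + r) = S x y) \<and>
    (\<exists>A>0. \<forall>x y \<xi>.
      (\<Sum>i\<in>UNIV. \<Sum>j\<in>UNIV. mixed_partial i j S x y * \<xi> $ i * \<xi> $ j) \<le> - A * (norm \<xi>)\<^sup>2)"

definition generates :: "(real^'d \<Rightarrow> real^'d \<Rightarrow> real) \<Rightarrow> ('d cotan \<Rightarrow> 'd cotan) \<Rightarrow> bool" where
  "generates S f \<longleftrightarrow>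
    (\<forall>x p x' p'. f (x, p) = (x', p') \<longleftrightarrow> p = - D1 S x x' \<and> p' = D2 S x x')"

text \<open>A map generated by a generating function is a diffeomorphism that commutes with the lattice
  translations, so these properties are consequences and not conditions below.\<close>

definition twist_map :: "('d::finite cotan_torus \<Rightarrow> 'd cotan_torus) \<Rightarrow> bool" where
  "twist_map F \<longleftrightarrow>
    (\<exists>S f. generating_function S \<and> generates S f \<and> (\<forall>z. F (cotan_proj z) = cotan_proj (f z)))"

definition is_lift ::
    "('d::finite cotan_torus \<Rightarrow> 'd cotan_torus) \<Rightarrow> ('d cotan \<Rightarrow> 'd cotan) \<Rightarrow> bool" where
  "is_lift F f \<longleftrightarrow> continuous_on UNIV f \<and> (\<forall>z. cotan_proj (f z) = F (cotan_proj z))"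

text \<open>Differentials of maps between manifolds covered by normed spaces, with covering
  projections \<open>q\<^sub>1\<close> and \<open>q\<^sub>2\<close> whose local inverses are the charts: \<open>L\<close> is the differential
  of \<open>G\<close> at \<open>b\<close>, in the trivialization of the tangent bundles induced by the coverings, if
  near every point over \<open>b\<close> the map \<open>G\<close> has a local lift with derivative \<open>L\<close> there.
  Such an \<open>L\<close> is unique if \<open>q\<^sub>1\<close> is surjective and local lifts through \<open>q\<^sub>2\<close> that are continuous
  at a point differ near it by a constant, as for \<open>torus_proj\<close> and \<open>cotan_proj\<close>.\<close>

definition has_differential ::
    "('a::real_normed_vector \<Rightarrow> 'b) \<Rightarrow> ('c::real_normed_vector \<Rightarrow> 'e) \<Rightarrow> ('b \<Rightarrow> 'e) \<Rightarrow>
     ('a \<Rightarrow> 'c) \<Rightarrow> 'b \<Rightarrow> bool" where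
  "has_differential q\<^sub>1 q\<^sub>2 G L b \<longleftrightarrow>
    (\<forall>a. q\<^sub>1 a = b \<longrightarrow>
      (\<exists>g. (\<forall>\<^sub>F u in nhds a. q\<^sub>2 (g u) = G (q\<^sub>1 u)) \<and> (g has_derivative L) (at a)))"

definition differential ::
    "('a::real_normed_vector \<Rightarrow> 'b) \<Rightarrow> ('c::real_normed_vector \<Rightarrow> 'e) \<Rightarrow> ('b \<Rightarrow> 'e) \<Rightarrow>
     'b \<Rightarrow> 'a \<Rightarrow> 'c" where
  "differential q\<^sub>1 q\<^sub>2 G b = (THE L. has_differential q\<^sub>1 q\<^sub>2 G L b)"

definition vertical :: "('d::finite) cotan_torus \<Rightarrow> 'd cotan set" where
  "vertical z = {v. differential cotan_proj torus_proj fst z v = 0}"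

definition int_iterate :: "('a \<Rightarrow> 'a) \<Rightarrow> int \<Rightarrow> 'a \<Rightarrow> 'a" where
  "int_iterate F n = (if 0 \<le> n then F ^^ nat n else inv F ^^ nat (- n))"

definition without_conjugate_points :: "('d::finite cotan_torus \<Rightarrow> 'd cotan_torus) \<Rightarrow> bool" where
  "without_conjugate_points F \<longleftrightarrow>
    (\<forall>z. \<forall>n. n \<noteq> 0 \<longrightarrow>
      vertical (int_iterate F n z) \<inter>
        differential cotan_proj cotan_proj (int_iterate F n) z ` vertical z = {0})"

end

theory Submission
  imports Defs
begin

text \<open>Let \<open>f\<close> be the lift given by the generating function \<open>S\<close>, and let the action of an
  orbit segment \<open>x\<^sub>0, \<dots>, x\<^sub>n\<close> of positions be the sum of the \<open>S (x\<^sub>i, x\<^sub>i\<^sub>+\<^sub>1)\<close>. Two facts carry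
  the proof.

  First, between any two points \<open>x\<close> and \<open>y\<close> there is exactly one orbit segment of length \<open>n\<close>, and
  it minimizes the action among all sequences from \<open>x\<close> to \<open>y\<close> (\<open>orbits_minimize\<close>). This goes by
  induction on \<open>n\<close>. Let \<open>\<alpha> z\<close> be the minimal action from \<open>x\<close> to \<open>z\<close> in \<open>n\<close> steps. The segments
  of length \<open>n + 1\<close> from \<open>x\<close> to \<open>y\<close> correspond to the critical points of \<open>z \<mapsto> \<alpha> z + S (z, y)\<close>,
  which is coercive by the twist condition. Every \<open>z\<close> is critical for exactly one
  \<open>y\<close>, so there is one Hessian for each \<open>z\<close>. The absence of conjugate points says that
  this Hessian is never degenerate, and it is positive semidefinite where \<open>z\<close> is a minimizer, so by
  connectedness it is positive definite for all \<open>z\<close> (\<open>posdef_along_connected_family\<close>). Thus all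
  critical points are strict local minima, and a minimax argument leaves room for only one
  (\<open>unique_critical_point\<close>).

  Second, let \<open>h x\<close> be the action of the unique segment of length \<open>N\<close> from \<open>x\<close> to \<open>x + r\<close>. The
  derivative of \<open>h\<close> is the final minus the initial momentum, so the assertion for all \<open>x\<close> means
  that \<open>h\<close> is constant. As \<open>h\<close> is periodic, it has a minimum and a maximum; these are critical, so
  the segments over them close up. Run them \<open>k\<close> times: the actions become \<open>k\<close> times the minimum
  and \<open>k\<close> times the maximum of \<open>h\<close>, and since both segments are minimizing and changing
  the endpoints costs an amount independent of \<open>k\<close>, the two values agree
  (\<open>periodic_orbits_action_le\<close>).

  Finally an arbitrary lift differs from \<open>f\<close> by an integer translation, which commutes with \<open>f\<close> and
  is absorbed into \<open>r\<close>.\<close>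

section \<open>Continuously differentiable maps\<close>

text \<open>Continuity of the derivative is joint continuity of the tangent map. On a Euclidean space this
  is continuity in the operator norm, and it composes without any bounds on operators.\<close>

definition C1 ::
    "('a::real_normed_vector \<Rightarrow> 'b::real_normed_vector) \<Rightarrow> ('a \<Rightarrow> 'a \<Rightarrow> 'b) \<Rightarrow> bool" where
  "C1 f f' \<longleftrightarrow>
    (\<forall>x. (f has_derivative f' x) (at x)) \<and> continuous_on UNIV (\<lambda>(x, v). f' x v)"

lemma C1_has_derivative: "C1 f f' \<Longrightarrow> (f has_derivative f' x) (at x within X)"
  by (auto simp: C1_def intro: has_derivative_at_withinI)

lemma C1_bounded_linear_deriv: "C1 f f' \<Longrightarrow> bounded_linear (f' x)"
  using C1_has_derivative has_derivative_bounded_linear by blast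

lemma C1_continuous_deriv:
  assumes "C1 f f'" "continuous_on X p" "continuous_on X q"
  shows "continuous_on X (\<lambda>x. f' (p x) (q x))"
proof -
  have "continuous_on X (\<lambda>x. (\<lambda>(x, v). f' x v) (p x, q x))"
    by (rule continuous_on_compose2[of UNIV])
      (use assms in \<open>auto simp: C1_def intro!: continuous_intros\<close>)
  then show ?thesis by simp
qed

lemma C1_continuous:
  assumes "C1 f f'" "continuous_on X p"
  shows "continuous_on X (\<lambda>x. f (p x))"
proof -
  have "continuous_on UNIV f"
    using C1_has_derivative[OF assms(1)] has_derivative_continuous_on by blast
  then show ?thesis
    by (rule continuous_on_compose2) (use assms in auto)
qed

lemma C1_compose:
  assumes "C1 f f'" "C1 g g'"
  shows "C1 (\<lambda>x. g (f x)) (\<lambda>x v. g' (f x) (f' x v))"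
  unfolding C1_def split_beta
proof (intro conjI allI)
  show "((\<lambda>x. g (f x)) has_derivative (\<lambda>v. g' (f x) (f' x v))) (at x)" for x
    by (rule has_derivative_compose) (use assms C1_has_derivative in auto)
  show "continuous_on UNIV (\<lambda>x. g' (f (fst x)) (f' (fst x) (snd x)))"
    by (intro C1_continuous_deriv[OF assms(2)] C1_continuous_deriv[OF assms(1)]
        C1_continuous[OF assms(1)] continuous_intros)
qed

lemma C1_Pair:
  assumes "C1 f f'" "C1 g g'"
  shows "C1 (\<lambda>x. (f x, g x)) (\<lambda>x v. (f' x v, g' x v))"
  unfolding C1_def split_beta
proof (intro conjI allI)
  show "((\<lambda>x. (f x, g x)) has_derivative (\<lambda>v. (f' x v, g' x v))) (at x)" for x
    by (intro has_derivative_Pair C1_has_derivative assms)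
  show "continuous_on UNIV (\<lambda>x. (f' (fst x) (snd x), g' (fst x) (snd x)))"
    by (intro C1_continuous_deriv[OF assms(2)] C1_continuous_deriv[OF assms(1)]
        continuous_intros)
qed

lemma C1_add:
  assumes "C1 f f'" "C1 g g'"
  shows "C1 (\<lambda>x. f x + g x) (\<lambda>x v. f' x v + g' x v)"
  unfolding C1_def split_beta
proof (intro conjI allI)
  show "((\<lambda>x. f x + g x) has_derivative (\<lambda>v. f' x v + g' x v)) (at x)" for x
    by (intro has_derivative_add C1_has_derivative assms)
  show "continuous_on UNIV (\<lambda>x. f' (fst x) (snd x) + g' (fst x) (snd x))"
    by (intro C1_continuous_deriv[OF assms(2)] C1_continuous_deriv[OF assms(1)]
        continuous_intros)
qed

lemma C1_bounded_linear:
  assumes "bounded_linear L"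
  shows "C1 L (\<lambda>x. L)"
  unfolding C1_def split_beta
  using assms
  by (auto intro!: bounded_linear_imp_has_derivative linear_continuous_on
      bounded_linear_compose[OF _ bounded_linear_snd])

lemma C1_const: "C1 (\<lambda>x. c) (\<lambda>x v. 0)"
  by (auto simp: C1_def split_beta)

text \<open>The inverse of the tangent map of \<open>f\<close> is the tangent map of the inverse of \<open>f\<close>, so
  invariance of domain, applied to the tangent map, gives the continuity of the derivative of
  the inverse.\<close>

lemma C1_inverse:
  fixes f :: "'a::euclidean_space \<Rightarrow> 'a"
  assumes f: "C1 f f'" and bij: "bij f" and inj: "\<And>x v. f' x v = 0 \<Longrightarrow> v = 0"
  shows "C1 (inv f) (\<lambda>y. inv (f' (inv f y)))"
proof -
  have lin: "linear (f' x)" for x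
    using C1_bounded_linear_deriv[OF f] bounded_linear.linear by blast
  have injf': "inj (f' x)" for x
    using inj lin linear_injective_0 by blast
  then have bijf': "bij (f' x)" for x
    by (intro bijI linear_injective_imp_surjective[OF lin]) auto
  have linv: "linear (inv (f' x))" for x
    using inj_linear_imp_inv_linear[OF lin injf'] .
  have surj: "f (inv f y) = y" for y
    by (meson bij bij_inv_eq_iff)
  have "continuous_on (f ` UNIV) (inv f)"
    by (rule continuous_on_inverse_open)
      (use bij C1_continuous[OF f continuous_on_id] in \<open>auto simp: bij_def\<close>)
  then have contg: "continuous_on UNIV (inv f)"
    using bij by (simp add: bij_def)
  \<comment> \<open>the tangent map and the tangent map of the inverse\<close>
  define T where "T = (\<lambda>(x, v). (f x, f' x v))"
  define G where "G = (\<lambda>(y, w). (inv f y, inv (f' (inv f y)) w))"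
  have GT: "G (T z) = z" for z
    using bij injf' by (auto simp: G_def T_def split_beta bij_def)
  have TG: "T (G z) = z" for z
    using surj bijf' by (auto simp: G_def T_def split_beta bij_def surj_f_inv_f)
  have "continuous_on UNIV T"
    unfolding T_def split_beta
    by (intro C1_continuous_deriv[OF f] C1_continuous[OF f] continuous_intros)
  then have "continuous_on (T ` UNIV) G"
    by (intro continuous_on_inverse_open) (auto simp: GT)
  moreover have "T ` UNIV = UNIV"
    using TG by (metis surjI)
  ultimately have "continuous_on UNIV (\<lambda>z. snd (G z))"
    by (auto intro!: continuous_intros)
  moreover have "(\<lambda>z. snd (G z)) = (\<lambda>(y, w). inv (f' (inv f y)) w)"
    by (auto simp: G_def)
  ultimately have "continuous_on UNIV (\<lambda>(y, w). inv (f' (inv f y)) w)"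
    by (simp only:)
  moreover have "(inv f has_derivative inv (f' (inv f y))) (at y)" for y
  proof (rule has_derivative_inverse_basic[where f = f and T = UNIV])
    show "(f has_derivative f' (inv f y)) (at (inv f y))"
      by (rule C1_has_derivative[OF f])
    show "bounded_linear (inv (f' (inv f y)))"
      using linv linear_conv_bounded_linear by blast
    show "inv (f' (inv f y)) \<circ> f' (inv f y) = id"
      using injf' by simp
    show "continuous (at y) (inv f)"
      using contg continuous_on_eq_continuous_at by blast
  qed (use surj in auto)
  ultimately show ?thesis
    unfolding C1_def by simp
qed

section \<open>Critical points of a function of several variables\<close>

lemma gradient_mvt:
  fixes G :: "'a::real_inner \<Rightarrow> real"
  assumes grad: "\<And>z. (G has_derivative (\<lambda>h. g z \<bullet> h)) (at z)"
  obtains \<theta> where "0 < \<theta>" "\<theta> < 1" "G (z + h) - G z = g (z + \<theta> *\<^sub>R h) \<bullet> h"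
proof -
  have "((\<lambda>t. G (z + t *\<^sub>R h)) has_derivative (\<lambda>s. g (z + t *\<^sub>R h) \<bullet> (s *\<^sub>R h))) (at t within {0..1})" for t
    by (rule has_derivative_compose[OF _ grad]) (auto intro!: derivative_eq_intros)
  from mvt_simple[OF zero_less_one this] obtain t where "t \<in> {0<..<1}"
    "G (z + 1 *\<^sub>R h) - G (z + 0 *\<^sub>R h) = g (z + t *\<^sub>R h) \<bullet> ((1 - 0) *\<^sub>R h)"
    by blast
  then show ?thesis using that by auto
qed

lemma has_derivative_error_bound:
  assumes "(g has_derivative H) (at z)" "e > 0"
  obtains d where "d > 0" "\<And>h. norm h < d \<Longrightarrow> norm (g (z + h) - g z - H h) \<le> e * norm h"
proof -
  obtain d where "d > 0" "\<forall>w. norm (w - z) < d \<longrightarrow> norm (g w - g z - H (w - z)) \<le> e * norm (w - z)"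
    using assms unfolding has_derivative_at_alt by blast
  then show ?thesis
    using that[of d] by (metis add_diff_cancel_left')
qed

text \<open>The second difference of \<open>G\<close> at \<open>z\<close> along \<open>t u\<close> and \<open>t v\<close> is symmetric in \<open>u\<close> and \<open>v\<close>. By the
  mean value theorem in the direction \<open>u\<close>, it is \<open>t\<^sup>2 (H v \<bullet> u)\<close> up to \<open>o(t\<^sup>2)\<close>.\<close>

lemma symmetric_second_derivative:
  fixes G :: "'a::real_inner \<Rightarrow> real"
  assumes grad: "\<And>z. (G has_derivative (\<lambda>h. g z \<bullet> h)) (at z)"
    and H: "(g has_derivative H) (at z)"
  shows "H u \<bullet> v = u \<bullet> H v"
proof -
  interpret H: bounded_linear H
    using H has_derivative_bounded_linear by blast
  define \<phi> where "\<phi> u v t = G (z + t *\<^sub>R u + t *\<^sub>R v) - G (z + t *\<^sub>R u) - G (z + t *\<^sub>R v) + G z"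
    for u v t
  have est: "\<exists>d>0. \<forall>t. 0 < t \<and> t < d \<longrightarrow> \<bar>\<phi> u v t - t\<^sup>2 * (H v \<bullet> u)\<bar> \<le> e * t\<^sup>2" if "e > 0" for e u v
  proof -
    define n where "n = 2 * norm u + norm v + 1"
    have n: "n > 0" "norm u \<le> n" "norm u + norm v < n" by (auto simp: n_def intro: add_nonneg_pos)
    obtain d where d: "d > 0" "\<And>h. norm h < d \<Longrightarrow> norm (g (z + h) - g z - H h) \<le> e / (2 * n * n) * norm h"
      using has_derivative_error_bound[OF H, of "e / (2 * n * n)"] \<open>e > 0\<close> n by auto
    have "\<bar>\<phi> u v t - t\<^sup>2 * (H v \<bullet> u)\<bar> \<le> e * t\<^sup>2" if t: "0 < t" "t < d / n" for t
    proof -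
      have gK: "((\<lambda>w. G (w + t *\<^sub>R v) - G w) has_derivative (\<lambda>h. (g (w + t *\<^sub>R v) - g w) \<bullet> h)) (at w)" for w
      proof -
        have "((\<lambda>w. G (w + t *\<^sub>R v)) has_derivative (\<lambda>h. g (w + t *\<^sub>R v) \<bullet> h)) (at w)"
          by (rule has_derivative_compose[OF _ grad]) (auto intro!: derivative_eq_intros)
        then show ?thesis
          using has_derivative_diff[OF _ grad] by (simp add: inner_diff_left)
      qed
      obtain \<theta> where \<theta>: "0 < \<theta>" "\<theta> < 1" and eq: "\<phi> u v t =
          (g (z + \<theta> *\<^sub>R (t *\<^sub>R u) + t *\<^sub>R v) - g (z + \<theta> *\<^sub>R (t *\<^sub>R u))) \<bullet> (t *\<^sub>R u)"
      proof (rule gradient_mvt[OF gK, of z "t *\<^sub>R u"])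
        fix \<theta> :: real
        assume \<theta>: "0 < \<theta>" "\<theta> < 1"
          and "G (z + t *\<^sub>R u + t *\<^sub>R v) - G (z + t *\<^sub>R u) - (G (z + t *\<^sub>R v) - G z) =
            (g (z + \<theta> *\<^sub>R t *\<^sub>R u + t *\<^sub>R v) - g (z + \<theta> *\<^sub>R t *\<^sub>R u)) \<bullet> (t *\<^sub>R u)"
        then show thesis
          by (intro that[of \<theta>]) (simp_all add: \<phi>_def)
      qed
      define p q where "p = \<theta> *\<^sub>R (t *\<^sub>R u) + t *\<^sub>R v" and "q = \<theta> *\<^sub>R (t *\<^sub>R u)"
      have "norm q \<le> t * norm u"
        using \<theta> t by (auto simp: q_def mult_left_le_one_le)
      then have pq: "norm q \<le> t * n" "norm p \<le> t * n"
      proof -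
        show "norm q \<le> t * n"
          using \<open>norm q \<le> t * norm u\<close> n t by (meson mult_left_mono order_trans less_imp_le)
        have "norm p \<le> norm q + norm (t *\<^sub>R v)"
          unfolding p_def q_def by (rule norm_triangle_ineq)
        also have "\<dots> \<le> t * (norm u + norm v)"
          using \<open>norm q \<le> t * norm u\<close> t by (simp add: algebra_simps)
        also have "\<dots> \<le> t * n"
          using n t by (intro mult_left_mono) auto
        finally show "norm p \<le> t * n" .
      qed
      have "t * n < d" using t n by (simp add: field_simps)
      have est1: "norm (g (z + h) - g z - H h) \<le> e / (2 * n) * t" if "norm h \<le> t * n" for h
      proof -
        have "norm (g (z + h) - g z - H h) \<le> e / (2 * n * n) * norm h"
          using d(2)[of h] that \<open>t * n < d\<close> by auto
        also have "\<dots> \<le> e / (2 * n * n) * (t * n)"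
          using that \<open>e > 0\<close> n by (intro mult_left_mono) auto
        finally show ?thesis using n by simp
      qed
      have Hpq: "H p - H q = t *\<^sub>R H v"
        by (simp add: p_def q_def H.add H.scaleR)
      have "norm (g (z + p) - g (z + q) - t *\<^sub>R H v)
          = norm ((g (z + p) - g z - H p) - (g (z + q) - g z - H q))"
        unfolding Hpq[symmetric] by (simp add: algebra_simps)
      also have "\<dots> \<le> e / (2 * n) * t + e / (2 * n) * t"
        using est1[OF pq(1)] est1[OF pq(2)]
        by (meson add_mono norm_triangle_ineq4 order_trans)
      also have "\<dots> = e / n * t" using n by (simp add: field_simps)
      finally have b: "norm (g (z + p) - g (z + q) - t *\<^sub>R H v) \<le> e / n * t" .
      have "\<phi> u v t - t\<^sup>2 * (H v \<bullet> u) = (g (z + p) - g (z + q) - t *\<^sub>R H v) \<bullet> (t *\<^sub>R u)"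
        unfolding eq p_def q_def by (simp add: algebra_simps power2_eq_square)
      also have "\<bar>\<dots>\<bar> \<le> (e / n * t) * (t * norm u)"
        using Cauchy_Schwarz_ineq2[of "g (z + p) - g (z + q) - t *\<^sub>R H v" "t *\<^sub>R u"]
          mult_right_mono[OF b, of "t * norm u"] t by auto
      also have "\<dots> \<le> (e / n * t) * (t * n)"
        using n t \<open>e > 0\<close> by (intro mult_left_mono) auto
      finally show ?thesis using n by (simp add: power2_eq_square)
    qed
    then show ?thesis
      using d n by (intro exI[of _ "d / n"]) auto
  qed
  have "\<bar>H v \<bullet> u - H u \<bullet> v\<bar> \<le> e" if "e > 0" for e
  proof -
    obtain d1 where d1: "d1 > 0" "\<And>t. 0 < t \<Longrightarrow> t < d1 \<Longrightarrow> \<bar>\<phi> u v t - t\<^sup>2 * (H v \<bullet> u)\<bar> \<le> e / 2 * t\<^sup>2"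
      using est[of "e / 2" u v] \<open>e > 0\<close> by auto
    obtain d2 where d2: "d2 > 0" "\<And>t. 0 < t \<Longrightarrow> t < d2 \<Longrightarrow> \<bar>\<phi> v u t - t\<^sup>2 * (H u \<bullet> v)\<bar> \<le> e / 2 * t\<^sup>2"
      using est[of "e / 2" v u] \<open>e > 0\<close> by auto
    define t where "t = min d1 d2 / 2"
    have t: "0 < t" "t < d1" "t < d2" using d1(1) d2(1) by (auto simp: t_def)
    have "\<phi> u v t = \<phi> v u t" by (simp add: \<phi>_def algebra_simps)
    then have "\<bar>t\<^sup>2 * (H v \<bullet> u) - t\<^sup>2 * (H u \<bullet> v)\<bar> \<le> e * t\<^sup>2"
      using d1(2)[OF t(1,2)] d2(2)[OF t(1,3)] by linarith
    then have "t\<^sup>2 * \<bar>H v \<bullet> u - H u \<bullet> v\<bar> \<le> t\<^sup>2 * e"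
      by (simp add: abs_mult flip: right_diff_distrib) (simp add: mult.commute)
    then show ?thesis using t by simp
  qed
  then have "\<bar>H v \<bullet> u - H u \<bullet> v\<bar> \<le> 0"
    by (meson field_le_epsilon add_le_same_cancel2 dense_ge)
  then show ?thesis by (simp add: inner_commute)
qed

lemma second_derivative_at_minimum:
  fixes G :: "'a::real_inner \<Rightarrow> real"
  assumes grad: "\<And>z. (G has_derivative (\<lambda>h. g z \<bullet> h)) (at z)"
    and H: "(g has_derivative H) (at z)" and crit: "g z = 0" and min: "\<And>w. G z \<le> G w"
  shows "0 \<le> H v \<bullet> v"
proof (rule ccontr)
  interpret H: bounded_linear H
    using H has_derivative_bounded_linear by blast
  define m where "m = - (H v \<bullet> v)"
  assume "\<not> 0 \<le> H v \<bullet> v"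
  then have m: "m > 0" and v: "v \<noteq> 0" by (auto simp: m_def)
  obtain d where d: "d > 0" "\<And>h. norm h < d \<Longrightarrow>
      norm (g (z + h) - g z - H h) \<le> m / (2 * (norm v)\<^sup>2) * norm h"
    using has_derivative_error_bound[OF H, of "m / (2 * (norm v)\<^sup>2)"] m v by auto
  define t where "t = d / (2 * norm v)"
  have t: "t > 0" "t * norm v < d" using d v by (auto simp: t_def)
  obtain \<theta> where \<theta>: "0 < \<theta>" "\<theta> < 1" "G (z + t *\<^sub>R v) - G z = g (z + \<theta> *\<^sub>R (t *\<^sub>R v)) \<bullet> (t *\<^sub>R v)"
    by (rule gradient_mvt[OF grad])
  let ?h = "\<theta> *\<^sub>R (t *\<^sub>R v)"
  have "norm ?h \<le> t * norm v" using \<theta> t by (auto simp: mult_left_le_one_le)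
  then have "norm (g (z + ?h) - H ?h) \<le> m / (2 * (norm v)\<^sup>2) * norm ?h"
    using d(2)[of ?h] t crit by auto
  then have "(g (z + ?h) - H ?h) \<bullet> v \<le> m / (2 * (norm v)\<^sup>2) * norm ?h * norm v"
    by (meson norm_cauchy_schwarz mult_right_mono norm_ge_zero order_trans)
  also have "\<dots> = m / 2 * (\<theta> * t)"
    using v \<theta> t by (simp add: power2_eq_square)
  finally have "g (z + ?h) \<bullet> v \<le> m / 2 * (\<theta> * t) + \<theta> * t * (H v \<bullet> v)"
    by (simp add: inner_diff_left H.scaleR)
  also have "\<dots> = - (m / 2 * (\<theta> * t))" by (simp add: m_def)
  also have "\<dots> < 0" using m \<theta> t by simp
  finally have "t * (g (z + ?h) \<bullet> v) < 0" using t by (simp add: mult_pos_neg)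
  then show False using \<theta>(3) min[of "z + t *\<^sub>R v"] by simp
qed

lemma strict_local_minimum:
  fixes G :: "'a::euclidean_space \<Rightarrow> real"
  assumes grad: "\<And>z. (G has_derivative (\<lambda>h. g z \<bullet> h)) (at z)"
    and H: "(g has_derivative H) (at z)" and crit: "g z = 0"
    and pos: "\<And>v. v \<noteq> 0 \<Longrightarrow> 0 < H v \<bullet> v"
  shows "\<exists>d>0. \<forall>w. w \<noteq> z \<and> dist w z < d \<longrightarrow> G z < G w"
proof -
  interpret H: bounded_linear H
    using H has_derivative_bounded_linear by blast
  have "continuous_on (sphere 0 1) (\<lambda>v. H v \<bullet> v)"
    by (intro continuous_intros H.continuous_on)
  moreover obtain b :: 'a where "b \<in> Basis" using nonempty_Basis by blast
  then have "sphere (0::'a) 1 \<noteq> {}" by (metis dist_0_norm empty_iff mem_sphere norm_Basis)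
  ultimately obtain v0 :: 'a where v0: "norm v0 = 1" "\<And>v. norm v = 1 \<Longrightarrow> H v0 \<bullet> v0 \<le> H v \<bullet> v"
    using continuous_attains_inf[of "sphere 0 1" "\<lambda>v. H v \<bullet> v"] by auto
  define m where "m = H v0 \<bullet> v0"
  have m: "m > 0" using v0(1) pos[of v0] by (fastforce simp: m_def)
  have quad: "m * (norm v)\<^sup>2 \<le> H v \<bullet> v" for v
  proof (cases "v = 0")
    case False
    have "m \<le> H ((1 / norm v) *\<^sub>R v) \<bullet> ((1 / norm v) *\<^sub>R v)"
      unfolding m_def using False by (intro v0(2)) auto
    then show ?thesis using False by (simp add: H.scaleR power2_eq_square field_simps)
  qed auto
  obtain d where d: "d > 0" "\<And>h. norm h < d \<Longrightarrow> norm (g (z + h) - g z - H h) \<le> m / 2 * norm h"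
    using has_derivative_error_bound[OF H, of "m / 2"] m by auto
  have "G z < G w" if w: "w \<noteq> z" "dist w z < d" for w
  proof -
    define v where "v = w - z"
    have v: "v \<noteq> 0" "norm v < d" using w by (auto simp: v_def dist_norm)
    obtain \<theta> where \<theta>: "0 < \<theta>" "\<theta> < 1" "G (z + v) - G z = g (z + \<theta> *\<^sub>R v) \<bullet> v"
      by (rule gradient_mvt[OF grad])
    have "norm (\<theta> *\<^sub>R v) \<le> norm v" using \<theta> by (auto simp: mult_left_le_one_le)
    then have "norm (\<theta> *\<^sub>R v) < d" using v by linarith
    then have "norm (g (z + \<theta> *\<^sub>R v) - H (\<theta> *\<^sub>R v)) \<le> m / 2 * norm (\<theta> *\<^sub>R v)"
      using d(2)[of "\<theta> *\<^sub>R v"] crit by simp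
    then have "norm (H (\<theta> *\<^sub>R v) - g (z + \<theta> *\<^sub>R v)) \<le> m / 2 * norm (\<theta> *\<^sub>R v)"
      by (simp only: norm_minus_commute)
    then have "(H (\<theta> *\<^sub>R v) - g (z + \<theta> *\<^sub>R v)) \<bullet> v \<le> m / 2 * norm (\<theta> *\<^sub>R v) * norm v"
      by (meson norm_cauchy_schwarz mult_right_mono norm_ge_zero order_trans)
    then have "g (z + \<theta> *\<^sub>R v) \<bullet> v \<ge> \<theta> * (H v \<bullet> v) - \<theta> * (m / 2 * (norm v)\<^sup>2)"
      using \<theta> by (simp add: inner_diff_left H.scaleR power2_eq_square field_simps)
    moreover have "\<theta> * (H v \<bullet> v) \<ge> \<theta> * (m * (norm v)\<^sup>2)"
      using quad \<theta> by (intro mult_left_mono) auto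
    moreover have "\<theta> * (m * (norm v)\<^sup>2) > 0" using \<theta> m v by simp
    ultimately have "g (z + \<theta> *\<^sub>R v) \<bullet> v > 0" by (simp add: algebra_simps)
    then show ?thesis using \<theta>(3) by (simp add: v_def)
  qed
  then show ?thesis using d(1) by blast
qed

text \<open>For a symmetric form, semidefinite and nondegenerate imply definite, so the set of parameters with
  semidefinite form is both closed and, by compactness of the unit sphere, open.\<close>

lemma posdef_along_connected_family:
  fixes H :: "'a::real_normed_vector \<Rightarrow> 'b::euclidean_space \<Rightarrow> 'b"
  assumes lin: "\<And>z. linear (H z)" and sym: "\<And>z u v. H z u \<bullet> v = u \<bullet> H z v"
    and cont: "continuous_on UNIV (\<lambda>(z, v). H z v)"
    and inj: "\<And>z v. H z v = 0 \<Longrightarrow> v = 0"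
    and psd: "\<And>v. 0 \<le> H z0 v \<bullet> v"
    and v: "v \<noteq> 0"
  shows "0 < H z v \<bullet> v"
proof -
  define P where "P = {z. \<forall>v. 0 \<le> H z v \<bullet> v}"
  have cont2: "continuous_on UNIV (\<lambda>p. H (fst p) (snd p) \<bullet> snd p)"
    using cont unfolding split_beta by (intro continuous_intros) auto
  have strict: "0 < H z v \<bullet> v" if "z \<in> P" "v \<noteq> 0" for z v
  proof (rule ccontr)
    interpret linear "H z" by (rule lin)
    assume "\<not> 0 < H z v \<bullet> v"
    then have zero: "H z v \<bullet> v = 0"
      using that by (auto simp: P_def intro: antisym)
    \<comment> \<open>the form is nonnegative along \<open>v - t w\<close>, and its derivative at \<open>t = 0\<close> is \<open>- 2 (w \<bullet> w)\<close>\<close>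
    define w where "w = H z v"
    define c where "c = H z w \<bullet> w"
    have c: "c \<ge> 0" using that by (auto simp: P_def c_def)
    have "w \<noteq> 0" using inj that by (auto simp: w_def)
    have ineq: "0 \<le> - 2 * t * (w \<bullet> w) + t\<^sup>2 * c" for t
    proof -
      have "0 \<le> H z (v - t *\<^sub>R w) \<bullet> (v - t *\<^sub>R w)" using that by (auto simp: P_def)
      also have "\<dots> = H z v \<bullet> v - t * (H z v \<bullet> w) - t * (H z w \<bullet> v) + t\<^sup>2 * c"
        by (simp add: diff scale inner_diff_left inner_diff_right c_def algebra_simps power2_eq_square)
      also have "\<dots> = - 2 * t * (w \<bullet> w) + t\<^sup>2 * c"
        using sym[of z w v] zero by (simp add: w_def inner_commute)
      finally show ?thesis .
    qed
    define t where "t = (w \<bullet> w) / (c + 1)"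
    have t: "t > 0" using \<open>w \<noteq> 0\<close> c by (simp add: t_def)
    have "t * (2 * (w \<bullet> w)) \<le> t * (t * c)"
      using ineq[of t] by (simp add: power2_eq_square algebra_simps)
    then have "2 * (w \<bullet> w) \<le> t * c" using t by simp
    also have "\<dots> \<le> t * (c + 1)" using t by simp
    also have "\<dots> = w \<bullet> w" using c by (simp add: t_def)
    finally have "w \<bullet> w \<le> 0" by simp
    then show False using \<open>w \<noteq> 0\<close> inner_gt_zero_iff[of w] by linarith
  qed
  have "closed P"
  proof -
    have "closed {z. 0 \<le> H z v \<bullet> v}" for v
    proof -
      have "continuous_on UNIV (\<lambda>z. H z v \<bullet> v)"
        using continuous_on_compose2[OF cont2, of UNIV "\<lambda>z. (z, v)"]
          continuous_on_Pair[OF continuous_on_id continuous_on_const, of UNIV v] by auto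
      then show ?thesis by (rule closed_Collect_le[OF continuous_on_const])
    qed
    then have "closed (\<Inter>v. {z. 0 \<le> H z v \<bullet> v})" by blast
    moreover have "P = (\<Inter>v. {z. 0 \<le> H z v \<bullet> v})" unfolding P_def by auto
    ultimately show ?thesis by simp
  qed
  moreover have "open P"
  proof (subst open_subopen, intro ballI)
    fix z assume z: "z \<in> P"
    let ?W = "{p. 0 < H (fst p) (snd p) \<bullet> snd p}"
    have "open ?W"
      by (rule open_Collect_less[OF continuous_on_const cont2])
    moreover have "{z} \<times> sphere 0 1 \<subseteq> ?W"
    proof (clarsimp)
      fix v :: 'b assume "norm v = 1"
      then show "0 < H z v \<bullet> v" by (intro strict[OF z]) auto
    qed
    ultimately have "\<exists>X. z \<in> X \<and> open X \<and> X \<times> sphere 0 1 \<subseteq> ?W"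
      by (rule Elementary_Topology.tube_lemma[OF compact_sphere])
    then obtain X where X: "z \<in> X" "open X" "X \<times> sphere 0 1 \<subseteq> ?W"
      by blast
    have "x \<in> P" if "x \<in> X" for x
      unfolding P_def
    proof (intro CollectI allI)
      fix v
      interpret linear "H x" by (rule lin)
      show "0 \<le> H x v \<bullet> v"
      proof (cases "v = 0")
        case False
        then have "(x, (1 / norm v) *\<^sub>R v) \<in> X \<times> sphere 0 1" using that by auto
        then have "0 < H x ((1 / norm v) *\<^sub>R v) \<bullet> ((1 / norm v) *\<^sub>R v)" using X(3) by fastforce
        then show ?thesis by (simp add: scale zero_less_divide_iff)
      qed auto
    qed
    then show "\<exists>T. open T \<and> z \<in> T \<and> T \<subseteq> P" using X by blast
  qed
  moreover have "z0 \<in> P" using psd by (auto simp: P_def)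
  ultimately have "P = UNIV" using clopen by blast
  then show ?thesis using strict v by blast
qed

lemma coercive_attains_minimum:
  fixes G :: "'a::euclidean_space \<Rightarrow> real"
  assumes cont: "continuous_on UNIV G" and coercive: "\<And>c. bounded {z. G z \<le> c}"
  obtains z where "\<And>w. G z \<le> G w"
proof -
  define X where "X = {z. G z \<le> G 0}"
  have "closed X"
    unfolding X_def by (intro closed_Collect_le cont continuous_on_const)
  then have "compact X"
    using coercive by (simp add: X_def compact_eq_bounded_closed)
  moreover have "0 \<in> X" by (simp add: X_def)
  ultimately obtain z where z: "z \<in> X" "\<And>w. w \<in> X \<Longrightarrow> G z \<le> G w"
    using continuous_attains_inf[of X G] continuous_on_subset[OF cont] by blast
  have "G z \<le> G w" for w
  proof (cases "w \<in> X")
    case False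
    then show ?thesis using z(1) by (auto simp: X_def)
  qed (rule z(2))
  then show ?thesis using that by blast
qed

text \<open>One step size serves a whole compact set, critical points included: the Lipschitz constant of the
  gradient near the set bounds the error of a step relative to the squared gradient.\<close>

lemma uniform_gradient_descent:
  fixes G :: "'a::euclidean_space \<Rightarrow> real"
  assumes grad: "\<And>z. (G has_derivative (\<lambda>h. g z \<bullet> h)) (at z)"
    and g: "C1 g g'" and L: "compact L"
  obtains t where "t > 0" "\<And>z. z \<in> L \<Longrightarrow> g z \<noteq> 0 \<Longrightarrow> G (z - t *\<^sub>R g z) < G z"
proof -
  obtain R where R: "R > 0" "\<And>z. z \<in> L \<Longrightarrow> norm z \<le> R"
    using compact_imp_bounded[OF L] bounded_pos by blast
  have "compact (g ` L)"
    by (intro compact_continuous_image L C1_continuous[OF g] continuous_intros)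
  then obtain M where M: "M > 0" "\<And>z. z \<in> L \<Longrightarrow> norm (g z) \<le> M"
    using compact_imp_bounded bounded_pos by (metis imageI)
  have "compact ((\<lambda>p. g' (fst p) (snd p)) ` (cball 0 (R + M) \<times> cball 0 1))"
    by (intro compact_continuous_image compact_Times compact_cball C1_continuous_deriv[OF g]
        continuous_intros)
  then obtain B0 where B0: "B0 > 0"
    "\<And>p. p \<in> cball 0 (R + M) \<times> cball 0 1 \<Longrightarrow> norm (g' (fst p) (snd p)) \<le> B0"
    using compact_imp_bounded bounded_pos by (metis (no_types, lifting) imageI)
  define B where "B = max B0 1"
  have B: "B \<ge> 1" by (simp add: B_def)
  have onorm: "onorm (g' w) \<le> B" if "w \<in> cball 0 (R + M)" for w
  proof (rule onorm_bound)
    interpret bounded_linear "g' w" by (rule C1_bounded_linear_deriv[OF g])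
    show "norm (g' w v) \<le> B * norm v" for v
    proof (cases "v = 0")
      case False
      have "norm (g' w ((1 / norm v) *\<^sub>R v)) \<le> B"
        using B0(2)[of "(w, (1 / norm v) *\<^sub>R v)"] that False by (auto simp: B_def)
      then show ?thesis using False by (simp add: scaleR field_simps)
    qed (simp add: zero)
  qed (use B in auto)
  define t where "t = 1 / (2 * B)"
  have t: "t > 0" "t \<le> 1" using B by (auto simp: t_def)
  have "G (z - t *\<^sub>R g z) < G z" if z: "z \<in> L" "g z \<noteq> 0" for z
  proof -
    obtain \<theta> where \<theta>: "0 < \<theta>" "\<theta> < 1"
      "G (z + (- t *\<^sub>R g z)) - G z = g (z + \<theta> *\<^sub>R (- t *\<^sub>R g z)) \<bullet> (- t *\<^sub>R g z)"
      by (rule gradient_mvt[OF grad])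
    define w where "w = z + \<theta> *\<^sub>R (- t *\<^sub>R g z)"
    have wz: "norm (w - z) \<le> t * norm (g z)"
      using \<theta> t by (auto simp: w_def mult_left_le_one_le)
    also have "\<dots> \<le> norm (g z)" using t by (simp add: mult_left_le_one_le)
    also have "\<dots> \<le> M" using M z by auto
    finally have "norm (w - z) \<le> M" .
    then have "norm w \<le> R + M"
      using norm_triangle_ineq[of "w - z" z] R(2)[OF z(1)] by auto
    moreover have "norm z \<le> R + M" using R(2)[OF z(1)] M(1) by auto
    ultimately have "norm (g w - g z) \<le> B * norm (w - z)"
      by (intro differentiable_bound[OF convex_cball[of 0 "R + M"] C1_has_derivative[OF g]] onorm) auto
    also have "\<dots> \<le> B * (t * norm (g z))" using wz B by (intro mult_left_mono) auto
    also have "\<dots> = norm (g z) / 2" using B by (simp add: t_def)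
    finally have "norm (g z - g w) \<le> norm (g z) / 2" by (simp add: norm_minus_commute)
    then have "(g z - g w) \<bullet> g z \<le> norm (g z) / 2 * norm (g z)"
      by (meson mult_right_mono norm_cauchy_schwarz norm_ge_zero order_trans)
    then have "g w \<bullet> g z \<ge> (norm (g z))\<^sup>2 / 2"
      by (simp add: inner_diff_left power2_norm_eq_inner[symmetric] power2_eq_square)
    then have "g w \<bullet> g z > 0"
      using z by (smt (verit) half_gt_zero zero_less_norm_iff zero_less_power)
    then have "t * (g w \<bullet> g z) > 0" using t by simp
    then show ?thesis using \<theta>(3) by (simp add: w_def)
  qed
  then show ?thesis using that t by blast
qed

text \<open>A mountain pass theorem. If there were two critical points, take the smallest level \<open>s\<close> at which a
  continuum in the sublevel set joins them. That continuum contains no critical point at level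
  \<open>s\<close>, since a strict local minimum at the top level would be isolated in it. Hence a gradient
  step, which fixes the two critical points, pushes it strictly below \<open>s\<close>, a contradiction.\<close>

lemma unique_critical_point:
  fixes G :: "'a::euclidean_space \<Rightarrow> real"
  assumes grad: "\<And>z. (G has_derivative (\<lambda>h. g z \<bullet> h)) (at z)"
    and g: "C1 g g'" and coercive: "\<And>c. bounded {z. G z \<le> c}"
    and strict: "\<And>z. g z = 0 \<Longrightarrow> \<exists>d>0. \<forall>w. w \<noteq> z \<and> dist w z < d \<longrightarrow> G z < G w"
    and crit: "g a = 0" "g b = 0"
  shows "a = b"
proof (rule ccontr)
  assume "a \<noteq> b"
  have contG: "continuous_on X G" for X
    by (rule has_derivative_continuous_on, rule has_derivative_at_withinI, rule grad)
  define K where "K c = connected_component_set {z. G z \<le> c} a" for c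
  define C where "C = {c. b \<in> K c}"
  have inC: "c \<in> C" if "connected X" "a \<in> X" "b \<in> X" "\<And>z. z \<in> X \<Longrightarrow> G z \<le> c" for c X
    using connected_component_maximal[of a X "{z. G z \<le> c}"] that by (auto simp: C_def K_def)
  have Kle: "G z \<le> c" if "z \<in> K c" for z c
    using that connected_component_subset[of "{z. G z \<le> c}" a] by (auto simp: K_def)
  have Kmono: "K c \<subseteq> K c'" if "c \<le> c'" for c c'
    unfolding K_def using that by (intro connected_component_mono) auto
  have aK: "a \<in> K c" if "c \<in> C" for c
    using that connected_component_in by (fastforce simp: C_def K_def)
  have "C \<noteq> {}"
  proof -
    have "\<exists>m\<in>closed_segment a b. \<forall>z\<in>closed_segment a b. G z \<le> G m"
      by (rule continuous_attains_sup[OF compact_segment _ contG]) auto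
    then obtain m where m: "\<And>z. z \<in> closed_segment a b \<Longrightarrow> G z \<le> G m" by blast
    have "G m \<in> C" by (rule inC[of "closed_segment a b"]) (auto intro: m)
    then show ?thesis by auto
  qed
  have bdd: "bdd_below C"
    using aK Kle by (meson bdd_below.I)
  define s where "s = Inf C"
  have above: "c \<in> C" if "c > s" for c
  proof -
    obtain c' where "c' \<in> C" "c' < c"
      using cInf_lessD[OF \<open>C \<noteq> {}\<close>, of c] \<open>c > s\<close> s_def by auto
    then show ?thesis using Kmono[of c' c] by (auto simp: C_def)
  qed
  \<comment> \<open>the minimax level \<open>s\<close> is attained by a continuum joining the two critical points\<close>
  define L where "L = (\<Inter>n::nat. K (s + 1 / (real n + 1)))"
  have compK: "compact (K c)" for c
  proof -
    have "closed {z. G z \<le> c}"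
      by (intro closed_Collect_le contG continuous_on_const)
    then have "closed (K c)"
      unfolding K_def by (rule closed_connected_component)
    moreover have "bounded (K c)"
      by (rule bounded_subset[OF coercive[of c]]) (use Kle in auto)
    ultimately show ?thesis by (simp add: compact_eq_bounded_closed)
  qed
  have "connected L"
    unfolding L_def
  proof (rule connected_nest)
    show "connected (K (s + 1 / (real n + 1)))" for n
      by (simp add: K_def)
    show "K (s + 1 / (real n + 1)) \<subseteq> K (s + 1 / (real m + 1))" if "m \<le> n" for m n
      using that by (intro Kmono) (simp add: frac_le)
  qed (rule compK)
  have "compact L"
    unfolding L_def by (rule compact_Inter) (use compK in auto)
  have "a \<in> L" "b \<in> L"
  proof -
    have "s + 1 / (real n + 1) \<in> C" for n by (rule above) simp
    then show "a \<in> L" "b \<in> L" using aK unfolding L_def C_def by auto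
  qed
  have Lle: "G z \<le> s" if "z \<in> L" for z
  proof (rule field_le_epsilon)
    fix e :: real assume "e > 0"
    then obtain n where "1 / (real n + 1) < e"
      by (metis nat_approx_posE of_nat_Suc add.commute)
    moreover have "G z \<le> s + 1 / (real n + 1)"
      using that Kle unfolding L_def by blast
    ultimately show "G z \<le> s + e" by linarith
  qed
  have noncrit: "g z \<noteq> 0" if z: "z \<in> L" "G z = s" for z
  proof
    assume "g z = 0"
    then obtain d where d: "d > 0" "\<And>w. w \<noteq> z \<Longrightarrow> dist w z < d \<Longrightarrow> G z < G w"
      using strict by blast
    have "L \<inter> ball z d = {z}"
      using d Lle z by (force simp: dist_commute)
    then have "openin (top_of_set L) {z}"
      by (metis open_ball openin_open)
    moreover have "closedin (top_of_set L) {z}"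
      using z by (simp add: closed_subset)
    ultimately have "L = {z}"
      using \<open>connected L\<close> unfolding connected_clopen by blast
    then show False using \<open>a \<in> L\<close> \<open>b \<in> L\<close> \<open>a \<noteq> b\<close> by auto
  qed
  \<comment> \<open>a gradient step fixes \<open>a\<close> and \<open>b\<close> and moves the continuum below the level \<open>s\<close>\<close>
  obtain t where t: "t > 0" "\<And>z. z \<in> L \<Longrightarrow> g z \<noteq> 0 \<Longrightarrow> G (z - t *\<^sub>R g z) < G z"
    using uniform_gradient_descent[OF grad g \<open>compact L\<close>] by blast
  define L' where "L' = (\<lambda>z. z - t *\<^sub>R g z) ` L"
  have cont: "continuous_on L (\<lambda>z. z - t *\<^sub>R g z)"
    by (intro continuous_intros C1_continuous[OF g])
  have L': "connected L'" "compact L'"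
    unfolding L'_def using \<open>connected L\<close> \<open>compact L\<close> cont
    by (auto intro: connected_continuous_image compact_continuous_image)
  have ab: "a \<in> L'" "b \<in> L'"
    unfolding L'_def using \<open>a \<in> L\<close> \<open>b \<in> L\<close> crit
    by (auto intro: image_eqI[of a _ a] image_eqI[of b _ b])
  have lt: "G w < s" if "w \<in> L'" for w
  proof -
    obtain z where z: "z \<in> L" "w = z - t *\<^sub>R g z" using \<open>w \<in> L'\<close> by (auto simp: L'_def)
    show ?thesis
    proof (cases "g z = 0")
      case True
      then show ?thesis using noncrit[OF z(1)] Lle[OF z(1)] z by fastforce
    next
      case False
      then show ?thesis using t(2)[OF z(1)] Lle[OF z(1)] z by auto
    qed
  qed
  have "\<exists>m\<in>L'. \<forall>z\<in>L'. G z \<le> G m"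
    by (rule continuous_attains_sup[OF L'(2) _ contG]) (use ab in auto)
  then obtain m where m: "m \<in> L'" "\<And>z. z \<in> L' \<Longrightarrow> G z \<le> G m" by blast
  have "G m \<in> C" by (rule inC[OF L'(1) ab m(2)])
  then have "s \<le> G m" unfolding s_def using bdd by (rule cInf_lower)
  then show False using lt[OF m(1)] by auto
qed

section \<open>Maps generated by a lattice-periodic function\<close>

text \<open>The situation of the universal cover, with covectors replaced by vectors through the inner product:
  \<open>s1\<close> and \<open>s2\<close> are the partial gradients of \<open>S\<close>, and the positions are translated by a set \<open>L\<close> for which
  \<open>K\<close> contains a fundamental domain.\<close>

locale generated_twist =
  fixes S :: "'a::euclidean_space \<times> 'a \<Rightarrow> real" and s1 s2 :: "'a \<times> 'a \<Rightarrow> 'a"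
    and s1' s2' :: "'a \<times> 'a \<Rightarrow> 'a \<times> 'a \<Rightarrow> 'a"
    and f :: "'a \<times> 'a \<Rightarrow> 'a \<times> 'a" and L K :: "'a set" and A :: real
  assumes S_deriv: "(S has_derivative (\<lambda>\<zeta>. s1 z \<bullet> fst \<zeta> + s2 z \<bullet> snd \<zeta>)) (at z)"
    and C1_s1: "C1 s1 s1'" and C1_s2: "C1 s2 s2'"
    and A: "A > 0" and twist: "s2' z (\<xi>, 0) \<bullet> \<xi> \<le> - A * (norm \<xi>)\<^sup>2"
    and periodic: "r \<in> L \<Longrightarrow> S (x + r, y + r) = S (x, y)"
    and compact_K: "compact K" and cocompact: "\<exists>r\<in>L. x - r \<in> K"
    and generated: "f (x, p) = (x', p') \<longleftrightarrow> p = - s1 (x, x') \<and> p' = s2 (x, x')"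
begin

subsection \<open>Growth of the generating function\<close>

lemma mixed_symmetric: "s1' z (0, \<eta>) \<bullet> \<xi> = s2' z (\<xi>, 0) \<bullet> \<eta>"
proof -
  have "(S has_derivative (\<lambda>h. (s1 z, s2 z) \<bullet> h)) (at z)" for z
    using S_deriv[of z] by (simp add: inner_prod_def)
  moreover have "((\<lambda>z. (s1 z, s2 z)) has_derivative (\<lambda>v. (s1' z v, s2' z v))) (at z)"
    by (intro has_derivative_Pair C1_has_derivative[OF C1_s1] C1_has_derivative[OF C1_s2])
  ultimately show ?thesis
    using symmetric_second_derivative[of S "\<lambda>z. (s1 z, s2 z)" "\<lambda>v. (s1' z v, s2' z v)" z "(0, \<eta>)" "(\<xi>, 0)"]
    by (simp add: inner_prod_def inner_commute)
qed

text \<open>The mixed derivative in the other order is the transpose of the one in the twist condition, and the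
  quadratic form of a matrix does not see the transposition.\<close>

lemma mixed_injective:
  assumes "s1' z (0, \<xi>) = 0"
  shows "\<xi> = 0"
proof -
  have "0 \<le> - A * (norm \<xi>)\<^sup>2"
    using mixed_symmetric[of z \<xi> \<xi>] twist[of z \<xi>] assms by simp
  then show ?thesis using A by (simp add: mult_le_0_iff)
qed

lemma gradient_periodic:
  assumes r: "r \<in> L"
  shows "s1 (x + r, y + r) = s1 (x, y)" "s2 (x + r, y + r) = s2 (x, y)"
proof -
  have "((\<lambda>z. S (z + (r, r))) has_derivative
      (\<lambda>\<zeta>. s1 ((x, y) + (r, r)) \<bullet> fst \<zeta> + s2 ((x, y) + (r, r)) \<bullet> snd \<zeta>)) (at (x, y))"
    by (rule has_derivative_compose[OF _ S_deriv]) (auto intro!: derivative_eq_intros)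
  moreover have "(\<lambda>z. S (z + (r, r))) = S"
    using periodic[OF r] by (auto simp: fun_eq_iff)
  ultimately have "(S has_derivative (\<lambda>\<zeta>. s1 (x + r, y + r) \<bullet> fst \<zeta> + s2 (x + r, y + r) \<bullet> snd \<zeta>))
      (at (x, y))"
    by simp
  from has_derivative_unique[OF this S_deriv]
  have eq: "s1 (x + r, y + r) \<bullet> \<xi> + s2 (x + r, y + r) \<bullet> \<eta> = s1 (x, y) \<bullet> \<xi> + s2 (x, y) \<bullet> \<eta>" for \<xi> \<eta>
    by (auto dest: fun_cong[of _ _ "(\<xi>, \<eta>)"])
  show "s1 (x + r, y + r) = s1 (x, y)"
    by (rule vector_eq_rdot[THEN iffD1]) (use eq[of _ 0] in simp)
  show "s2 (x + r, y + r) = s2 (x, y)"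
    by (rule vector_eq_rdot[THEN iffD1]) (use eq[of 0] in simp)
qed

lemma S_continuous:
  assumes "continuous_on X p"
  shows "continuous_on X (\<lambda>x. S (p x))"
proof -
  have "continuous_on UNIV S"
    by (rule has_derivative_continuous_on, rule has_derivative_at_withinI, rule S_deriv)
  then show ?thesis by (rule continuous_on_compose2) (use assms in auto)
qed

text \<open>Along the segment from \<open>x\<close> to \<open>x + v\<close>, the slope of \<open>S (x, \<cdot>)\<close> differs from the slope at the
  diagonal, which is bounded by periodicity, by an integral of the mixed derivative. So the slope grows
  linearly with the distance travelled, and \<open>S\<close> quadratically.\<close>

lemma S_quadratic_growth:
  obtains c C where "\<And>x v. - c - C * norm v + A / 2 * (norm v)\<^sup>2 \<le> S (x, x + v)"
proof -
  have "bounded ((\<lambda>w. S (w, w)) ` K)"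
    by (intro compact_imp_bounded compact_continuous_image S_continuous compact_K continuous_intros)
  then obtain c where c: "\<And>w. w \<in> K \<Longrightarrow> \<bar>S (w, w)\<bar> \<le> c"
    by (auto simp: bounded_iff)
  have "bounded ((\<lambda>w. s2 (w, w)) ` K)"
    by (intro compact_imp_bounded compact_continuous_image C1_continuous[OF C1_s2] compact_K
        continuous_intros)
  then obtain C where C: "\<And>w. w \<in> K \<Longrightarrow> norm (s2 (w, w)) \<le> C"
    by (auto simp: bounded_iff)
  have diag: "- c \<le> S (w, w)" "norm (s2 (w, w)) \<le> C" for w
  proof -
    obtain r where r: "r \<in> L" "w - r \<in> K" using cocompact by blast
    show "- c \<le> S (w, w)"
      using c[OF r(2)] periodic[OF r(1), of "w - r" "w - r"] by simp
    show "norm (s2 (w, w)) \<le> C"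
      using C[OF r(2)] gradient_periodic(2)[OF r(1), of "w - r" "w - r"] by simp
  qed
  have "- c - C * norm v + A / 2 * (norm v)\<^sup>2 \<le> S (x, x + v)" for x v
  proof -
    \<comment> \<open>moving the first argument from \<open>x + t v\<close> back to \<open>x\<close> uses the twist condition\<close>
    have slope: "s2 (x, x + t *\<^sub>R v) \<bullet> v \<ge> - C * norm v + A * t * (norm v)\<^sup>2" if "0 \<le> t" for t
    proof -
      have "\<exists>k\<in>{0..t}. s2 (x + t *\<^sub>R v, x + t *\<^sub>R v) \<bullet> v - s2 (x + 0 *\<^sub>R v, x + t *\<^sub>R v) \<bullet> v
          = s2' (x + k *\<^sub>R v, x + t *\<^sub>R v) ((t - 0) *\<^sub>R v, 0) \<bullet> v"
      proof (rule mvt_very_simple)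
        show "((\<lambda>k. s2 (x + k *\<^sub>R v, x + t *\<^sub>R v) \<bullet> v) has_derivative
            (\<lambda>h. s2' (x + k *\<^sub>R v, x + t *\<^sub>R v) (h *\<^sub>R v, 0) \<bullet> v)) (at k within {0..t})" for k
          by (intro has_derivative_inner_left has_derivative_compose[OF _ C1_has_derivative[OF C1_s2]])
            (auto intro!: derivative_eq_intros)
      qed (use that in auto)
      then obtain k where "s2 (x + t *\<^sub>R v, x + t *\<^sub>R v) \<bullet> v - s2 (x, x + t *\<^sub>R v) \<bullet> v
          = s2' (x + k *\<^sub>R v, x + t *\<^sub>R v) (t *\<^sub>R v, 0) \<bullet> v" by auto
      also have "\<dots> = t * (s2' (x + k *\<^sub>R v, x + t *\<^sub>R v) (v, 0) \<bullet> v)"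
      proof -
        interpret bounded_linear "s2' (x + k *\<^sub>R v, x + t *\<^sub>R v)"
          by (rule C1_bounded_linear_deriv[OF C1_s2])
        show ?thesis using scaleR[of t "(v, 0)"] by simp
      qed
      also have "\<dots> \<le> t * (- A * (norm v)\<^sup>2)"
        using that by (intro mult_left_mono twist)
      finally have "s2 (x, x + t *\<^sub>R v) \<bullet> v \<ge> s2 (x + t *\<^sub>R v, x + t *\<^sub>R v) \<bullet> v + A * t * (norm v)\<^sup>2"
        by (simp add: algebra_simps)
      moreover have "\<bar>s2 (x + t *\<^sub>R v, x + t *\<^sub>R v) \<bullet> v\<bar> \<le> C * norm v"
        by (meson Cauchy_Schwarz_ineq2 diag(2) mult_right_mono norm_ge_zero order_trans)
      ultimately show ?thesis by linarith
    qed
    define \<psi> where "\<psi> t = S (x, x + t *\<^sub>R v) + C * norm v * t - A / 2 * (norm v)\<^sup>2 * t\<^sup>2" for t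
    have "\<psi> 0 \<le> \<psi> 1"
    proof (rule DERIV_nonneg_imp_nondecreasing[where f = \<psi>])
      fix t :: real assume t: "0 \<le> t" "t \<le> 1"
      have "((\<lambda>t. S (x, x + t *\<^sub>R v)) has_derivative
          (\<lambda>h. s1 (x, x + t *\<^sub>R v) \<bullet> fst (0, h *\<^sub>R v) + s2 (x, x + t *\<^sub>R v) \<bullet> snd (0 :: 'a, h *\<^sub>R v))) (at t)"
        by (rule has_derivative_compose[OF _ S_deriv]) (auto intro!: derivative_eq_intros)
      then have "((\<lambda>t. S (x, x + t *\<^sub>R v)) has_real_derivative s2 (x, x + t *\<^sub>R v) \<bullet> v) (at t)"
        by (simp add: has_field_derivative_def mult_commute_abs)
      then have "(\<psi> has_real_derivative
          s2 (x, x + t *\<^sub>R v) \<bullet> v + C * norm v - A / 2 * (norm v)\<^sup>2 * (2 * t)) (at t)"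
        unfolding \<psi>_def by (auto intro!: derivative_eq_intros)
      then show "\<exists>y. (\<psi> has_real_derivative y) (at t) \<and> 0 \<le> y"
        using slope[OF t(1)] by (intro exI conjI) (auto simp: algebra_simps)
    qed simp
    then show ?thesis using diag(1)[of x] by (simp add: \<psi>_def)
  qed
  then show ?thesis using that by blast
qed

lemma S_bounded_below:
  obtains m where "\<And>z. m \<le> S z"
proof -
  obtain c C where cC: "\<And>x v. - c - C * norm v + A / 2 * (norm v)\<^sup>2 \<le> S (x, x + v)"
    using S_quadratic_growth by blast
  have "- c - C\<^sup>2 / (2 * A) \<le> S (x, y)" for x y
  proof -
    have "0 \<le> A / 2 * (norm (y - x) - C / A)\<^sup>2" using A by simp
    also have "\<dots> = A / 2 * (norm (y - x))\<^sup>2 - C * norm (y - x) + C\<^sup>2 / (2 * A)"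
      using A by (simp add: power2_eq_square field_simps)
    finally show ?thesis using cC[of "y - x" x] by simp
  qed
  then show ?thesis using that by (metis prod.collapse)
qed

lemma S_coercive: "bounded {z. S (z, y) \<le> b}"
proof -
  obtain c C where cC: "\<And>x v. - c - C * norm v + A / 2 * (norm v)\<^sup>2 \<le> S (x, x + v)"
    using S_quadratic_growth by blast
  define R where "R = \<bar>2 * (C + 1) / A\<bar> + \<bar>b\<bar> + \<bar>c\<bar> + 1"
  have "norm (y - z) \<le> R" if "S (z, y) \<le> b" for z
  proof (rule ccontr)
    define q where "q = norm (y - z)"
    assume "\<not> norm (y - z) \<le> R"
    then have q: "q > R" by (simp add: q_def)
    then have "q > 2 * (C + 1) / A" unfolding R_def by linarith
    then have "A / 2 * q - C > 1" using A by (simp add: field_simps)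
    moreover have "q > 0" "q > b + c" using q unfolding R_def by linarith+
    ultimately have "q * 1 \<le> q * (A / 2 * q - C)" by (intro mult_left_mono) auto
    then have "b + c < A / 2 * q\<^sup>2 - C * q"
      using \<open>q > b + c\<close> by (simp add: power2_eq_square algebra_simps)
    then show False using cC[of "y - z" z] that by (simp add: q_def)
  qed
  then have "{z. S (z, y) \<le> b} \<subseteq> cball y R" by (auto simp: dist_norm)
  then show ?thesis using bounded_cball bounded_subset by blast
qed

subsection \<open>Orbits and their action\<close>

lemma generated_iff: "f (x, - s1 (x, y)) = (y, s2 (x, y))"
  by (simp add: generated)

lemma s1_injective: "s1 (x, y) = s1 (x, y') \<Longrightarrow> y = y'"
  by (metis generated_iff prod.inject)

text \<open>The position after one step solves the implicit equation \<open>p = - s1 (x, x')\<close>. The map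
  \<open>(x, x') \<mapsto> (x, - s1 (x, x'))\<close> is a bijection because \<open>S\<close> generates \<open>f\<close>, and an immersion by the twist
  condition.\<close>

lemma f_C1: "\<exists>f'. C1 f f'"
proof -
  define \<Psi> where "\<Psi> = (\<lambda>z. (fst z, - s1 z))"
  define \<Psi>' where "\<Psi>' = (\<lambda>z \<zeta>. (fst \<zeta>, - s1' z \<zeta>) :: 'a \<times> 'a)"
  have "C1 \<Psi> \<Psi>'"
    unfolding \<Psi>_def \<Psi>'_def
    by (intro C1_Pair C1_bounded_linear[OF bounded_linear_fst]
        C1_compose[OF C1_s1 C1_bounded_linear[OF bounded_linear_minus[OF bounded_linear_ident]]])
  moreover have sol: "\<Psi> (fst z, fst (f z)) = z" for z
    using generated[of "fst z" "snd z" "fst (f z)" "snd (f z)"]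
    by (simp add: \<Psi>_def prod_eq_iff)
  have "inj \<Psi>"
    by (rule injI) (auto simp: \<Psi>_def dest: s1_injective)
  then have bij: "bij \<Psi>"
    by (rule bijI[OF _ surjI[of \<Psi>, OF sol]])
  moreover have "\<zeta> = 0" if "\<Psi>' z \<zeta> = 0" for z \<zeta>
    using that mixed_injective[of z "snd \<zeta>"] by (cases \<zeta>) (auto simp: \<Psi>'_def zero_prod_def)
  ultimately have I: "C1 (inv \<Psi>) (\<lambda>y. inv (\<Psi>' (inv \<Psi> y)))"
    by (rule C1_inverse)
  have inv: "inv \<Psi> z = (fst z, fst (f z))" for z
    using sol bij by (metis bij_inv_eq_iff)
  have "f z = (snd (inv \<Psi> z), s2 (inv \<Psi> z))" for z
    unfolding inv using generated[of "fst z" "snd z" "fst (f z)" "snd (f z)"]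
    by (simp add: prod_eq_iff)
  then have "f = (\<lambda>z. (snd (inv \<Psi> z), s2 (inv \<Psi> z)))" by blast
  then show ?thesis
    using C1_Pair[OF C1_compose[OF I C1_bounded_linear[OF bounded_linear_snd]] C1_compose[OF I C1_s2]]
    by auto
qed

lemma iterate_C1: "\<exists>D. C1 (f ^^ n) D"
proof (induction n)
  case 0
  show ?case
    using C1_bounded_linear[OF bounded_linear_ident] by (auto simp: id_def)
next
  case (Suc n)
  obtain D f' where "C1 (f ^^ n) D" "C1 f f'" using Suc f_C1 by blast
  from C1_compose[OF this] show ?case by (auto simp: comp_def)
qed

definition pos :: "nat \<Rightarrow> 'a \<times> 'a \<Rightarrow> 'a" where "pos n z = fst ((f ^^ n) z)"
definition mom :: "nat \<Rightarrow> 'a \<times> 'a \<Rightarrow> 'a" where "mom n z = snd ((f ^^ n) z)"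
definition action :: "nat \<Rightarrow> 'a \<times> 'a \<Rightarrow> real" where
  "action n z = (\<Sum>i<n. S (pos i z, pos (Suc i) z))"

lemma pos_0 [simp]: "pos 0 z = fst z" and mom_0 [simp]: "mom 0 z = snd z"
  by (auto simp: pos_def mom_def)

lemma iterate_eq: "(f ^^ n) z = (pos n z, mom n z)"
  by (simp add: pos_def mom_def)

lemma mom_eq: "mom n z = - s1 (pos n z, pos (Suc n) z)"
  and mom_Suc_eq: "mom (Suc n) z = s2 (pos n z, pos (Suc n) z)"
proof -
  have "f (pos n z, mom n z) = (pos (Suc n) z, mom (Suc n) z)"
    using iterate_eq[of "Suc n" z] by (simp add: iterate_eq)
  then show "mom n z = - s1 (pos n z, pos (Suc n) z)" "mom (Suc n) z = s2 (pos n z, pos (Suc n) z)"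
    by (auto simp: generated)
qed

lemma pos_add: "pos (m + n) z = pos m ((f ^^ n) z)"
  by (simp add: pos_def funpow_add)

lemma action_Suc: "action (Suc n) z = action n z + S (pos n z, pos (Suc n) z)"
  by (simp add: action_def)

lemma action_add: "action (m + n) z = action n z + action m ((f ^^ n) z)"
  by (induction m) (simp_all add: action_def pos_add[symmetric] add.assoc)

lemma C1_pos: "C1 (f ^^ n) D \<Longrightarrow> C1 (pos n) (\<lambda>z v. fst (D z v))"
  using C1_compose[OF _ C1_bounded_linear[OF bounded_linear_fst], of "f ^^ n" D]
  by (simp add: pos_def[abs_def])

lemma C1_mom: "C1 (f ^^ n) D \<Longrightarrow> C1 (mom n) (\<lambda>z v. snd (D z v))"
  using C1_compose[OF _ C1_bounded_linear[OF bounded_linear_snd], of "f ^^ n" D]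
  by (simp add: mom_def[abs_def])

text \<open>Exactness of the symplectic map: the action is a primitive of the difference between the pullback of
  the Liouville form under the \<open>n\<close>-th iterate and the form itself. By the generating equations,
  the terms at the intermediate positions cancel.\<close>

lemma action_has_derivative:
  assumes "C1 (f ^^ n) D"
  shows "(action n has_derivative (\<lambda>\<zeta>. mom n z \<bullet> fst (D z \<zeta>) - snd z \<bullet> fst \<zeta>)) (at z)"
  using assms
proof (induction n arbitrary: D)
  case 0
  have "((\<lambda>z. z) has_derivative D z) (at z)"
    using C1_has_derivative[OF 0] by (simp add: id_def)
  then have "D z = (\<lambda>z. z)"
    using has_derivative_unique[OF _ has_derivative_ident] by blast
  then show ?case by (simp add: action_def[abs_def])
next
  case (Suc n)
  obtain E where E: "C1 (f ^^ n) E" using iterate_C1 by blast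
  have "((\<lambda>z. S (pos n z, pos (Suc n) z)) has_derivative (\<lambda>\<zeta>. s1 (pos n z, pos (Suc n) z) \<bullet> fst (fst (E z \<zeta>), fst (D z \<zeta>))
      + s2 (pos n z, pos (Suc n) z) \<bullet> snd (fst (E z \<zeta>), fst (D z \<zeta>)))) (at z)"
    by (intro has_derivative_compose[OF _ S_deriv] has_derivative_Pair
        C1_has_derivative[OF C1_pos] E Suc.prems)
  from has_derivative_add[OF Suc.IH[OF E] this] show ?case
    unfolding action_Suc[abs_def] mom_Suc_eq by (simp add: mom_eq[of n] algebra_simps)
qed

text \<open>The derivative of \<open>f\<close> is invertible: differentiating the two generating equations recovers a tangent
  vector from its image, the position part through the twist condition. This turns
  \<open>V \<inter> D V = {0}\<close>, a condition on image vectors, into one on the initial vertical vectors.\<close>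

lemma iterate_derivative_injective:
  assumes "(f ^^ n has_derivative D) (at z)" "D \<zeta> = 0"
  shows "\<zeta> = 0"
  using assms
proof (induction n arbitrary: D \<zeta>)
  case 0
  then have "((\<lambda>z. z) has_derivative D) (at z)" by (simp add: id_def)
  from has_derivative_unique[OF this has_derivative_ident] show ?case using 0(2) by simp
next
  case (Suc n)
  obtain E f' where E: "C1 (f ^^ n) E" and f': "C1 f f'" using iterate_C1 f_C1 by blast
  define w where "w = (f ^^ n) z"
  have "((\<lambda>z. f ((f ^^ n) z)) has_derivative (\<lambda>v. f' w (E z v))) (at z)"
    unfolding w_def by (rule C1_has_derivative[OF C1_compose[OF E f']])
  then have "D = (\<lambda>v. f' w (E z v))"
    using has_derivative_unique Suc.prems(1) by (auto simp: comp_def)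
  define \<omega> where "\<omega> = E z \<zeta>"
  have zero: "f' w \<omega> = 0" using Suc.prems(2) \<open>D = _\<close> by (simp add: \<omega>_def)
  have eqs: "snd w = - s1 (fst w, fst (f w))" "snd (f w) = s2 (fst w, fst (f w))" for w
    using generated[of "fst w" "snd w" "fst (f w)" "snd (f w)"] by auto
  have pair: "((\<lambda>w. (fst w, fst (f w))) has_derivative (\<lambda>v. (fst v, fst (f' w v)))) (at w)"
    by (intro has_derivative_Pair has_derivative_fst has_derivative_ident C1_has_derivative[OF f'])
  have "((\<lambda>w. snd (f w)) has_derivative (\<lambda>v. s2' (fst w, fst (f w)) (fst v, fst (f' w v)))) (at w)"
    unfolding eqs(2) by (rule has_derivative_compose[OF pair C1_has_derivative[OF C1_s2]])
  from has_derivative_unique[OF this has_derivative_snd[OF C1_has_derivative[OF f']]]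
  have "s2' (fst w, fst (f w)) (fst v, fst (f' w v)) = snd (f' w v)" for v by metis
  from this[of \<omega>] have "s2' (fst w, fst (f w)) (fst \<omega>, 0) = 0" by (simp add: zero)
  then have "0 \<le> - A * (norm (fst \<omega>))\<^sup>2"
    using twist[of "(fst w, fst (f w))" "fst \<omega>"] by simp
  then have fst0: "fst \<omega> = 0" using A by (simp add: mult_le_0_iff)
  have "((\<lambda>w. snd w) has_derivative (\<lambda>v. - s1' (fst w, fst (f w)) (fst v, fst (f' w v)))) (at w)"
    unfolding eqs(1)
    by (intro has_derivative_minus has_derivative_compose[OF pair C1_has_derivative[OF C1_s1]])
  from has_derivative_unique[OF this has_derivative_snd[OF has_derivative_ident]]
  have "- s1' (fst w, fst (f w)) (fst v, fst (f' w v)) = snd v" for v by metis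
  from this[of \<omega>] have "snd \<omega> = 0"
    using linear_simps(3)[OF C1_bounded_linear_deriv[OF C1_s1]] by (simp add: zero fst0 flip: zero_prod_def)
  then have "\<omega> = 0" using fst0 by (simp add: prod_eq_iff)
  then show ?case
    using Suc.IH[OF C1_has_derivative[OF E]] by (simp add: \<omega>_def)
qed

subsection \<open>Lattice translations\<close>

lemma iterate_translate:
  assumes r: "r \<in> L"
  shows "pos n (x + r, p) = pos n (x, p) + r" "mom n (x + r, p) = mom n (x, p)"
proof -
  have "pos n (x + r, p) = pos n (x, p) + r \<and> mom n (x + r, p) = mom n (x, p)"
  proof (induction n)
    case (Suc n)
    have "f (pos n (x, p) + r, mom n (x, p)) = (pos (Suc n) (x, p) + r, mom (Suc n) (x, p))"
      unfolding generated gradient_periodic[OF r] mom_Suc_eq by (simp flip: mom_eq)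
    moreover have "f (pos n (x + r, p), mom n (x + r, p)) = (pos (Suc n) (x + r, p), mom (Suc n) (x + r, p))"
      using iterate_eq[of "Suc n" "(x + r, p)"] by (simp add: iterate_eq)
    ultimately show ?case using Suc by simp
  qed simp
  then show "pos n (x + r, p) = pos n (x, p) + r" "mom n (x + r, p) = mom n (x, p)" by auto
qed

lemma action_translate: "r \<in> L \<Longrightarrow> action n (x + r, p) = action n (x, p)"
  by (simp add: action_def iterate_translate periodic)

lemma iterate_translate_multiple:
  "r \<in> L \<Longrightarrow> pos n (x + real k *\<^sub>R r, p) = pos n (x, p) + real k *\<^sub>R r"
  "r \<in> L \<Longrightarrow> mom n (x + real k *\<^sub>R r, p) = mom n (x, p)"
  "r \<in> L \<Longrightarrow> action n (x + real k *\<^sub>R r, p) = action n (x, p)"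
  "r \<in> L \<Longrightarrow> S (x + real k *\<^sub>R r, y + real k *\<^sub>R r) = S (x, y)"
proof (induction k)
  case (Suc k)
  have eq: "w + real (Suc k) *\<^sub>R r = (w + real k *\<^sub>R r) + r" for w
    by (simp add: algebra_simps)
  {
    case 1 then show ?case unfolding eq using Suc iterate_translate by simp
  next
    case 2 then show ?case unfolding eq using Suc iterate_translate by simp
  next
    case 3 then show ?case unfolding eq using Suc action_translate by simp
  next
    case 4 then show ?case unfolding eq using Suc periodic by simp
  }
qed auto

end

section \<open>Twist maps without conjugate points\<close>

text \<open>The absence of conjugate points says that the position after \<open>n\<close> steps is an immersion in the
  initial momentum.\<close>

locale twist_without_conjugate_points = generated_twist +
  assumes no_conjugate_points:
    "n \<ge> 1 \<Longrightarrow> (f ^^ n has_derivative D) (at z) \<Longrightarrow> fst (D (0, \<eta>)) = 0 \<Longrightarrow> \<eta> = 0"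
begin

subsection \<open>Orbits without conjugate points minimize the action\<close>

text \<open>With \<open>x\<close> fixed, let \<open>Q z\<close> be the initial momentum of the segment of length \<open>n\<close> from \<open>x\<close> to \<open>z\<close>,
  \<open>\<pi> z\<close> its final momentum, \<open>\<alpha> z\<close> its action, and \<open>Y z\<close> its continuation by one more step. Then \<open>\<pi>\<close> is
  the gradient of \<open>\<alpha>\<close>, and \<open>z\<close> is a critical point of \<open>G y = \<alpha> + S (\<cdot>, y)\<close> exactly if \<open>Y z = y\<close>. So
  \<open>Y\<close> is surjective because each \<open>G y\<close> has a minimizer, and injective once the critical point of \<open>G y\<close>
  is unique. The Hessian \<open>H z\<close> of \<open>G (Y z)\<close> at \<open>z\<close> is minus the product of the mixed derivative of
  \<open>S\<close> and the derivative of \<open>Y\<close>, so it is nondegenerate when \<open>Y\<close> is an immersion.\<close>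

lemma orbits_minimize_step:
  assumes n: "n \<ge> 1" and bij: "bij (\<lambda>p. pos n (x, p))"
    and min: "\<And>p u. u 0 = x \<Longrightarrow> u n = pos n (x, p) \<Longrightarrow>
      action n (x, p) \<le> (\<Sum>i<n. S (u i, u (Suc i)))"
  shows "bij (\<lambda>p. pos (Suc n) (x, p))"
    and "\<And>p u. u 0 = x \<Longrightarrow> u (Suc n) = pos (Suc n) (x, p) \<Longrightarrow>
      action (Suc n) (x, p) \<le> (\<Sum>i<Suc n. S (u i, u (Suc i)))"
proof -
  obtain D where D: "C1 (f ^^ n) D" using iterate_C1 by blast
  obtain E where E: "C1 (f ^^ Suc n) E" using iterate_C1 by blast
  define Q where "Q = inv (\<lambda>p. pos n (x, p))"
  have posQ: "pos n (x, Q z) = z" for z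
    unfolding Q_def by (rule surj_f_inv_f[of "\<lambda>p. pos n (x, p)"]) (rule bij_is_surj[OF bij])
  have Qpos: "Q (pos n (x, p)) = p" for p
    unfolding Q_def by (rule inv_f_f[of "\<lambda>p. pos n (x, p)"]) (rule bij_is_inj[OF bij])
  have C1_inj: "C1 (\<lambda>p. (x, p)) (\<lambda>p v. (0, v))"
    by (rule C1_Pair[OF C1_const C1_bounded_linear[OF bounded_linear_ident]])
  obtain Q' where Q': "C1 Q Q'"
  proof
    show "C1 Q (\<lambda>y. inv (\<lambda>v. fst (D (x, Q y) (0, v))))"
      unfolding Q_def
      using C1_compose[OF C1_inj C1_pos[OF D]] bij
        no_conjugate_points[OF n C1_has_derivative[OF D]] by (rule C1_inverse)
  qed
  have xQ: "C1 (\<lambda>z. (x, Q z)) (\<lambda>z v. (0, Q' z v))"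
    by (rule C1_compose[OF Q' C1_inj])
  have DQ': "fst (D (x, Q z) (0, Q' z v)) = v" for z v
  proof -
    have "((\<lambda>z. z) has_derivative (\<lambda>v. fst (D (x, Q z) (0, Q' z v)))) (at z)"
      using C1_has_derivative[OF C1_compose[OF xQ C1_pos[OF D]]] by (simp add: posQ)
    from has_derivative_unique[OF this has_derivative_ident] show ?thesis by metis
  qed
  define \<alpha> where "\<alpha> z = action n (x, Q z)" for z
  define \<pi> where "\<pi> z = mom n (x, Q z)" for z
  define \<pi>' where "\<pi>' z v = snd (D (x, Q z) (0, Q' z v))" for z v
  define Y where "Y z = pos (Suc n) (x, Q z)" for z
  define Y' where "Y' z v = fst (E (x, Q z) (0, Q' z v))" for z v
  have \<pi>: "C1 \<pi> \<pi>'" and Y: "C1 Y Y'"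
    unfolding \<pi>_def \<pi>'_def Y_def Y'_def
    using C1_compose[OF xQ C1_mom[OF D]] C1_compose[OF xQ C1_pos[OF E]] by auto
  have \<pi>_eq: "\<pi> z = - s1 (z, Y z)" for z
    unfolding \<pi>_def Y_def by (subst mom_eq) (simp add: posQ)
  have \<alpha>: "(\<alpha> has_derivative (\<lambda>h. \<pi> z \<bullet> h)) (at z)" for z
  proof -
    have "(\<alpha> has_derivative (\<lambda>h. mom n (x, Q z) \<bullet> fst (D (x, Q z) (0, Q' z h)) - snd (x, Q z) \<bullet> fst (0 :: 'a, Q' z h))) (at z)"
      unfolding \<alpha>_def
      by (rule has_derivative_compose[OF C1_has_derivative[OF xQ] action_has_derivative[OF D]])
    then show ?thesis by (simp add: DQ' \<pi>_def)
  qed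
  define G where "G y z = \<alpha> z + S (z, y)" for y z
  define g where "g y z = \<pi> z + s1 (z, y)" for y z
  have grad: "(G y has_derivative (\<lambda>h. g y z \<bullet> h)) (at z)" for y z
  proof -
    have "((\<lambda>z. S (z, y)) has_derivative (\<lambda>h. s1 (z, y) \<bullet> fst (h, 0 :: 'a) + s2 (z, y) \<bullet> snd (h, 0))) (at z)"
      by (rule has_derivative_compose[OF _ S_deriv]) (auto intro!: derivative_eq_intros)
    from has_derivative_add[OF \<alpha> this] show ?thesis
      unfolding G_def g_def by (simp add: inner_add_left)
  qed
  have C1_y: "C1 (\<lambda>z. (z, y)) (\<lambda>z v. (v, 0))" for y :: 'a
    by (rule C1_Pair[OF C1_bounded_linear[OF bounded_linear_ident] C1_const])
  have g': "C1 (g y) (\<lambda>z v. \<pi>' z v + s1' (z, y) (v, 0))" for y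
    unfolding g_def by (rule C1_add[OF \<pi> C1_compose[OF C1_y C1_s1]])
  have crit: "g y z = 0 \<longleftrightarrow> Y z = y" for y z
    using s1_injective by (auto simp: g_def \<pi>_eq)
  obtain m where m: "\<And>z. m \<le> S z" using S_bounded_below by blast
  have coercive: "bounded {z. G y z \<le> c}" for y c
  proof (rule bounded_subset[OF S_coercive])
    have "real n * m \<le> \<alpha> z" for z
      unfolding \<alpha>_def action_def using sum_bounded_below[of "{..<n}" m] m by simp
    then show "{z. G y z \<le> c} \<subseteq> {z. S (z, y) \<le> c - real n * m}"
      unfolding G_def by (smt (verit) Collect_mono)
  qed
  have contG: "continuous_on UNIV (G y)" for y
    by (rule has_derivative_continuous_on, rule has_derivative_at_withinI, rule grad)
  have minimizer: "\<exists>z. Y z = y \<and> (\<forall>w. G y z \<le> G y w)" for y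
  proof -
    obtain z where z: "\<And>w. G y z \<le> G y w"
      using coercive_attains_minimum[of "G y", OF contG coercive] by blast
    have "(\<lambda>h. g y z \<bullet> h) = (\<lambda>h. 0)"
      by (rule differential_zero_maxmin[OF _ open_UNIV grad]) (use z in auto)
    then have "g y z = 0" by (metis inner_eq_zero_iff)
    then show ?thesis using z crit by blast
  qed
  define H where "H z v = \<pi>' z v + s1' (z, Y z) (v, 0)" for z v
  have gH: "(g (Y z) has_derivative H z) (at z)" for z
    using C1_has_derivative[OF g'] by (simp add: H_def[abs_def])
  \<comment> \<open>any value of \<open>y\<close> provides a point \<open>z0\<close> where the Hessian is semidefinite\<close>
  obtain z0 where z0: "Y z0 = 0" "\<And>w. G 0 z0 \<le> G 0 w" using minimizer by blast
  have posdef: "0 < H z v \<bullet> v" if "v \<noteq> 0" for z v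
  proof (rule posdef_along_connected_family[where H = H and ?z0.0 = z0])
    show "linear (H z)" for z
      using gH has_derivative_linear by blast
    show "H z u \<bullet> v = u \<bullet> H z v" for z u v
      by (rule symmetric_second_derivative[OF grad gH])
    show "continuous_on UNIV (\<lambda>(z, v). H z v)"
      unfolding H_def split_beta
      by (intro continuous_intros C1_continuous_deriv[OF \<pi>] C1_continuous_deriv[OF C1_s1]
          C1_continuous[OF Y])
    show "v = 0" if "H z v = 0" for z v
    proof -
      interpret bounded_linear "s1' (z, Y z)" by (rule C1_bounded_linear_deriv[OF C1_s1])
      have "((\<lambda>z. - s1 (z, Y z)) has_derivative (\<lambda>v. - s1' (z, Y z) (v, Y' z v))) (at z)"
        by (intro has_derivative_minus has_derivative_compose[OF _ C1_has_derivative[OF C1_s1]]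
            has_derivative_Pair has_derivative_ident C1_has_derivative[OF Y])
      moreover have "\<pi> = (\<lambda>z. - s1 (z, Y z))" using \<pi>_eq by blast
      ultimately have "\<pi>' z = (\<lambda>v. - s1' (z, Y z) (v, Y' z v))"
        using has_derivative_unique[OF C1_has_derivative[OF \<pi>]] by blast
      then have "H z v = s1' (z, Y z) (v, 0) - s1' (z, Y z) (v, Y' z v)" by (simp add: H_def)
      also have "\<dots> = - s1' (z, Y z) (0, Y' z v)"
        by (simp flip: diff neg)
      finally have "Y' z v = 0" using that mixed_injective by simp
      then have "Q' z v = 0"
        unfolding Y'_def using no_conjugate_points[OF _ C1_has_derivative[OF E]] by simp
      then show "v = 0"
        using DQ'[of z v] C1_bounded_linear_deriv[OF D, of "(x, Q z)"]
        by (simp add: linear_simps(3) zero_prod_def[symmetric])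
    qed
    show "0 \<le> H z0 v \<bullet> v" for v
      by (rule second_derivative_at_minimum[OF grad gH]) (use z0 crit in auto)
  qed (rule that)
  have Y_inj: "z = w" if "Y z = Y w" for z w
  proof (rule unique_critical_point[OF grad g' coercive])
    show "g (Y w) z = 0" "g (Y w) w = 0" using that crit by auto
    fix z' assume "g (Y w) z' = 0"
    then have Yz': "Y w = Y z'" using crit by simp
    show "\<exists>d>0. \<forall>w'. w' \<noteq> z' \<and> dist w' z' < d \<longrightarrow> G (Y w) z' < G (Y w) w'"
      unfolding Yz' by (rule strict_local_minimum[OF grad gH _ posdef]) (simp_all add: crit)
  qed
  have pos_Y: "pos (Suc n) (x, p) = Y (pos n (x, p))" for p
    by (simp add: Y_def Qpos)
  show "bij (\<lambda>p. pos (Suc n) (x, p))"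
  proof (rule bijI)
    show "inj (\<lambda>p. pos (Suc n) (x, p))"
      by (rule injI) (metis pos_Y Y_inj Qpos)
    show "surj (\<lambda>p. pos (Suc n) (x, p))"
    proof (rule surjI)
      fix y
      have "\<exists>z. Y z = y" using minimizer by blast
      then have "Y (SOME z. Y z = y) = y" by (rule someI_ex)
      then show "pos (Suc n) (x, Q (SOME z. Y z = y)) = y" by (simp add: Y_def)
    qed
  qed
  show "action (Suc n) (x, p) \<le> (\<Sum>i<Suc n. S (u i, u (Suc i)))"
    if u: "u 0 = x" "u (Suc n) = pos (Suc n) (x, p)" for p u
  proof -
    define y where "y = pos (Suc n) (x, p)"
    define z where "z = pos n (x, p)"
    \<comment> \<open>the minimizer of \<open>G y\<close> is its only critical point, so it lies on the orbit\<close>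
    obtain z1 where z1: "Y z1 = y" "\<And>w. G y z1 \<le> G y w" using minimizer by blast
    have "z1 = z" using z1(1) Y_inj by (simp add: y_def z_def pos_Y)
    have "action (Suc n) (x, p) = G y z"
      unfolding action_Suc G_def \<alpha>_def y_def z_def by (simp add: Qpos)
    also have "\<dots> \<le> G y (u n)" using z1(2) \<open>z1 = z\<close> by blast
    also have "\<dots> \<le> (\<Sum>i<n. S (u i, u (Suc i))) + S (u n, y)"
      unfolding G_def \<alpha>_def using min[of u "Q (u n)"] u(1) by (simp add: posQ)
    finally show ?thesis using u(2) by (simp add: y_def)
  qed
qed

lemma orbits_minimize:
  assumes "n \<ge> 1"
  shows "bij (\<lambda>p. pos n (x, p)) \<and> (\<forall>p u. u 0 = x \<longrightarrow> u n = pos n (x, p) \<longrightarrow>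
      action n (x, p) \<le> (\<Sum>i<n. S (u i, u (Suc i))))"
  using assms
proof (induction n rule: nat_induct_at_least)
  case base
  have "bij (\<lambda>p. pos 1 (x, p))"
  proof (rule bijI)
    show "inj (\<lambda>p. pos 1 (x, p))"
    proof (rule injI)
      fix p q assume "pos 1 (x, p) = pos 1 (x, q)"
      then show "p = q" using mom_eq[of 0 "(x, p)"] mom_eq[of 0 "(x, q)"] by simp
    qed
    show "surj (\<lambda>p. pos 1 (x, p))"
      by (rule surjI[of _ "\<lambda>y. - s1 (x, y)"]) (simp add: pos_def generated_iff)
  qed
  then show ?case by (auto simp: action_def)
next
  case (Suc n)
  show ?case
    using orbits_minimize_step[OF Suc.hyps, of x] Suc.IH by blast
qed

lemma orbit_unique: "n \<ge> 1 \<Longrightarrow> pos n (x, p) = pos n (x, q) \<Longrightarrow> p = q"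
  using orbits_minimize[of n x] by (auto dest: bij_is_inj injD)

lemma orbit_exists:
  assumes "n \<ge> 1"
  shows "\<exists>p. y = pos n (x, p)"
proof -
  have "surj (\<lambda>p. pos n (x, p))"
    using orbits_minimize[OF assms, of x] by (auto simp: bij_def)
  from surjD[OF this] show ?thesis by simp
qed

lemma orbit_minimizes:
  "n \<ge> 1 \<Longrightarrow> u 0 = x \<Longrightarrow> u n = pos n (x, p) \<Longrightarrow> action n (x, p) \<le> (\<Sum>i<n. S (u i, u (Suc i)))"
  using orbits_minimize[of n x] by blast

subsection \<open>Periodic orbits\<close>

lemma periodic_orbit_multiple:
  assumes r: "r \<in> L" and per: "(f ^^ N) (x, p) = (x + r, p)"
  shows "(f ^^ (k * N)) (x, p) = (x + real k *\<^sub>R r, p) \<and> action (k * N) (x, p) = real k * action N (x, p)"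
proof (induction k)
  case (Suc k)
  have "(f ^^ (Suc k * N)) (x, p) = (f ^^ N) (x + real k *\<^sub>R r, p)"
    using Suc by (simp add: funpow_add)
  also have "\<dots> = (x + real (Suc k) *\<^sub>R r, p)"
    using per unfolding iterate_eq by (simp add: iterate_translate_multiple[OF r] algebra_simps)
  finally have "(f ^^ (Suc k * N)) (x, p) = (x + real (Suc k) *\<^sub>R r, p)" .
  moreover have "action (Suc k * N) (x, p) = action (k * N) (x, p) + action N (x + real k *\<^sub>R r, p)"
    using Suc by (simp add: action_add)
  ultimately show ?case
    using Suc by (simp add: iterate_translate_multiple[OF r] algebra_simps)
qed (simp add: action_def)

text \<open>Both closed orbits are repeated \<open>k\<close> times. Replacing the two endpoints of the second one by those of
  the first yields a competitor for the first, whose excess \<open>C\<close> over \<open>k\<close> times the second action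
  does not depend on \<open>k\<close>.\<close>

lemma periodic_orbits_action_le:
  assumes N: "N \<ge> 1" and r: "r \<in> L"
    and per: "(f ^^ N) (x, p) = (x + r, p)" "(f ^^ N) (y, q) = (y + r, q)"
  shows "action N (x, p) \<le> action N (y, q)"
proof -
  define C where "C = S (x, pos 1 (y, q)) - S (y, pos 1 (y, q))
      + (S (pos (N - 1) (y, q), x + r) - S (pos (N - 1) (y, q), y + r))"
  have split_ends: "(\<Sum>i<Suc (Suc M). t i) = t 0 + (\<Sum>i<M. t (Suc i)) + t (Suc M)"
    for M and t :: "nat \<Rightarrow> real"
    by (subst sum.lessThan_Suc_shift) simp
  have le: "real k * (action N (x, p) - action N (y, q)) \<le> C" if "k \<ge> 2" for k
  proof -
    \<comment> \<open>a sequence of length \<open>k * N\<close> has \<open>M\<close> steps between its first and its last one\<close>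
    define M where "M = k * N - 2"
    have M: "k * N = Suc (Suc M)"
      using that N by (auto simp: M_def) (metis One_nat_def Suc_1 add_2_eq_Suc le_add_diff_inverse mult_le_mono nat_mult_1_right)
    have last: "Suc M = (N - 1) + (k - 1) * N"
    proof -
      have "Suc (Suc M) = N + (k - 1) * N" using M that by (cases k) auto
      then show ?thesis using N by simp
    qed
    \<comment> \<open>the path follows the orbit of \<open>(y, q)\<close>, except at its two endpoints\<close>
    define u where "u i = (if i = 0 then x else if i = k * N then x + real k *\<^sub>R r else pos i (y, q))" for i
    have endpos: "pos (k * N) (x, p) = x + real k *\<^sub>R r" "pos (k * N) (y, q) = y + real k *\<^sub>R r"
      using periodic_orbit_multiple[OF r per(1)] periodic_orbit_multiple[OF r per(2)]
      by (simp_all add: pos_def)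
    have shift: "S (pos (Suc M) (y, q), w + real k *\<^sub>R r) = S (pos (N - 1) (y, q), w + r)" for w
    proof -
      have "pos (Suc M) (y, q) = pos (N - 1) (y, q) + real (k - 1) *\<^sub>R r"
        unfolding last pos_add using periodic_orbit_multiple[OF r per(2)]
        by (simp add: iterate_translate_multiple[OF r])
      moreover have "w + real k *\<^sub>R r = (w + r) + real (k - 1) *\<^sub>R r"
        using that by (simp add: algebra_simps of_nat_diff)
      ultimately show ?thesis by (simp only: iterate_translate_multiple[OF r])
    qed
    have "real k * action N (x, p) = action (k * N) (x, p)"
      using periodic_orbit_multiple[OF r per(1)] by simp
    also have "\<dots> \<le> (\<Sum>i<k * N. S (u i, u (Suc i)))"
      by (rule orbit_minimizes) (use endpos(1) M in \<open>auto simp: u_def\<close>)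
    also have "\<dots> = S (u 0, u 1) + (\<Sum>i<M. S (u (Suc i), u (Suc (Suc i)))) + S (u (Suc M), u (Suc (Suc M)))"
      unfolding M split_ends by simp
    also have "\<dots> = S (x, pos 1 (y, q)) + (\<Sum>i<M. S (pos (Suc i) (y, q), pos (Suc (Suc i)) (y, q)))
        + S (pos (Suc M) (y, q), x + real k *\<^sub>R r)"
      unfolding u_def M by (auto intro!: sum.cong)
    also have "\<dots> = action (k * N) (y, q) + S (x, pos 1 (y, q)) - S (y, pos 1 (y, q))
        + (S (pos (Suc M) (y, q), x + real k *\<^sub>R r) - S (pos (Suc M) (y, q), y + real k *\<^sub>R r))"
      unfolding endpos(2)[symmetric] action_def M split_ends by simp
    also have "action (k * N) (y, q) = real k * action N (y, q)"
      using periodic_orbit_multiple[OF r per(2)] by simp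
    finally show ?thesis unfolding shift C_def by (simp add: algebra_simps)
  qed
  show ?thesis
  proof (rule ccontr)
    assume "\<not> ?thesis"
    then have d: "action N (x, p) - action N (y, q) > 0" by simp
    obtain k where k: "real k > C / (action N (x, p) - action N (y, q))"
      using reals_Archimedean2 by blast
    then have "real (max k 2) * (action N (x, p) - action N (y, q)) > C"
      using d by (smt (verit) max.cobounded1 of_nat_mono pos_divide_less_eq mult_right_mono)
    then show False using le[of "max k 2"] by simp
  qed
qed

text \<open>Here \<open>z x\<close> is the initial state of the unique segment from \<open>x\<close> to \<open>x + r\<close>, so \<open>h x\<close> is its action.
  It is a smooth function of \<open>x\<close> because \<open>\<Theta>\<close>, which sends a state to its initial position and its position
  after \<open>N\<close> steps, is a diffeomorphism.\<close>

theorem unique_periodic_momentum: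
  assumes N: "N \<ge> 1" and r: "r \<in> L"
  shows "\<exists>!p. (f ^^ N) (x, p) = (x + r, p)"
proof -
  obtain D where D: "C1 (f ^^ N) D" using iterate_C1 by blast
  define \<Theta> where "\<Theta> z = (fst z, pos N z)" for z
  have C1_\<Theta>: "C1 \<Theta> (\<lambda>z \<zeta>. (fst \<zeta>, fst (D z \<zeta>)))"
    unfolding \<Theta>_def by (intro C1_Pair C1_bounded_linear bounded_linear_fst C1_pos D)
  have bij: "bij \<Theta>"
  proof (rule bijI)
    show "inj \<Theta>"
      by (rule injI) (auto simp: \<Theta>_def dest: orbit_unique[OF N])
    show "surj \<Theta>"
      unfolding surj_def
    proof
      fix w
      obtain p where "snd w = pos N (fst w, p)" using orbit_exists[OF N] by auto
      then show "\<exists>z. w = \<Theta> z"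
        by (intro exI[of _ "(fst w, p)"]) (simp add: \<Theta>_def prod_eq_iff)
    qed
  qed
  have \<Theta>'_inj: "\<zeta> = 0" if "(fst \<zeta>, fst (D z \<zeta>)) = 0" for z \<zeta>
    using that no_conjugate_points[OF N C1_has_derivative[OF D], of z "snd \<zeta>"]
    by (cases \<zeta>) (auto simp: zero_prod_def)
  obtain I where I: "C1 (inv \<Theta>) I"
  proof
    show "C1 (inv \<Theta>) (\<lambda>y. inv (\<lambda>\<zeta>. (fst \<zeta>, fst (D (inv \<Theta> y) \<zeta>))))"
      by (rule C1_inverse[OF C1_\<Theta> bij \<Theta>'_inj])
  qed
  define z where "z x = inv \<Theta> (x, x + r)" for x
  have "\<Theta> (z x) = (x, x + r)" for x
    unfolding z_def by (rule surj_f_inv_f[OF bij_is_surj[OF bij]])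
  then have z: "fst (z x) = x" "pos N (z x) = x + r" for x
    by (simp_all add: \<Theta>_def)
  have z_unique: "z x = (x, p)" if "pos N (x, p) = x + r" for x p
    using orbit_unique[OF N, of x p "snd (z x)"] z[of x] that by (metis prod.collapse)
  have "C1 (\<lambda>x. (x, x + r)) (\<lambda>x v. (v, v + 0))"
    by (intro C1_Pair C1_add C1_const C1_bounded_linear bounded_linear_ident)
  from C1_compose[OF this I] obtain z' where z': "C1 z z'"
    by (auto simp: z_def[abs_def])
  have fst_z': "fst (z' x v) = v" and pos_z': "fst (D (z x) (z' x v)) = v" for x v
  proof -
    have "((\<lambda>x. x) has_derivative (\<lambda>v. fst (z' x v))) (at x)"
      using C1_has_derivative[OF C1_compose[OF z' C1_bounded_linear[OF bounded_linear_fst]], of x]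
      by (simp add: z)
    from has_derivative_unique[OF this has_derivative_ident] show "fst (z' x v) = v" by metis
    have "((\<lambda>x. x + r) has_derivative (\<lambda>v. fst (D (z x) (z' x v)))) (at x)"
      using C1_has_derivative[OF C1_compose[OF z' C1_pos[OF D]], of x] by (simp add: z)
    moreover have "((\<lambda>x. x + r) has_derivative (\<lambda>v. v)) (at x)"
      by (auto intro!: derivative_eq_intros)
    ultimately show "fst (D (z x) (z' x v)) = v" using has_derivative_unique by metis
  qed
  define h where "h x = action N (z x)" for x
  have h_deriv: "(h has_derivative (\<lambda>v. (mom N (z x) - snd (z x)) \<bullet> v)) (at x)" for x
    unfolding h_def
    using has_derivative_compose[OF C1_has_derivative[OF z'] action_has_derivative[OF D], of x]
    by (simp add: fst_z' pos_z' inner_diff_left)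
  have crit: "(f ^^ N) (z x) = (x + r, snd (z x)) \<and> z x = (x, snd (z x))"
    if "(\<forall>w. h w \<le> h x) \<or> (\<forall>w. h x \<le> h w)" for x
  proof -
    have "(\<lambda>v. (mom N (z x) - snd (z x)) \<bullet> v) = (\<lambda>v. 0)"
      by (rule differential_zero_maxmin[OF _ open_UNIV h_deriv]) (use that in auto)
    then have "mom N (z x) = snd (z x)" by (metis inner_eq_zero_iff right_minus_eq)
    then show ?thesis using z[of x] by (simp add: iterate_eq prod_eq_iff)
  qed
  have h_periodic: "h (x + s) = h x" if "s \<in> L" for x s
  proof -
    have "pos N (x + s, snd (z x)) = x + s + r"
      using iterate_translate(1)[OF that, of N x "snd (z x)"] z[of x]
      by (metis add.assoc add.commute prod.collapse)
    then have "z (x + s) = (x + s, snd (z x))" by (rule z_unique)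
    then show ?thesis
      unfolding h_def using action_translate[OF that] z(1)[of x] by (metis prod.collapse)
  qed
  have conth: "continuous_on K h"
    by (rule has_derivative_continuous_on, rule has_derivative_at_withinI, rule h_deriv)
  have "K \<noteq> {}" using cocompact by blast
  have reduce: "\<exists>w\<in>K. h x = h w" for x
    using cocompact[of x] h_periodic by (metis diff_add_cancel)
  obtain a where a: "\<And>w. w \<in> K \<Longrightarrow> h a \<le> h w"
    using continuous_attains_inf[OF compact_K \<open>K \<noteq> {}\<close> conth] by blast
  obtain b where b: "\<And>w. w \<in> K \<Longrightarrow> h w \<le> h b"
    using continuous_attains_sup[OF compact_K \<open>K \<noteq> {}\<close> conth] by blast
  have ab: "h a \<le> h w" "h w \<le> h b" for w
    using reduce[of w] a b by auto
  \<comment> \<open>the segments over the minimum \<open>a\<close> and the maximum \<open>b\<close> are closed orbits\<close>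
  have "h b \<le> h a"
    unfolding h_def
    using periodic_orbits_action_le[OF N r, of b "snd (z b)" a "snd (z a)"] crit[of a] crit[of b] ab
    by simp
  then have const: "h x = h w" for x w
    using ab[of x] ab[of w] by linarith
  have "(f ^^ N) (z x) = (x + r, snd (z x)) \<and> z x = (x, snd (z x))"
    by (rule crit) (auto intro: order_eq_refl const)
  then have "(f ^^ N) (x, snd (z x)) = (x + r, snd (z x))"
    by metis
  moreover have "p = snd (z x)" if "(f ^^ N) (x, p) = (x + r, p)" for p
    using z_unique[of x p] that by (simp add: pos_def)
  ultimately show ?thesis by blast
qed

end

section \<open>Differentials on the cotangent bundle of the torus\<close>

lemma torus_proj_eq_iff: "torus_proj x = torus_proj y \<longleftrightarrow> x - y \<in> int_lattice"
  by (simp add: torus.abs_eq_iff lattice_rel_def)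

lemma int_lattice_diff: "r \<in> int_lattice \<Longrightarrow> s \<in> int_lattice \<Longrightarrow> r - s \<in> int_lattice"
  by (simp add: int_lattice_def)

lemma int_lattice_norm_ge_1:
  assumes "r \<in> int_lattice" "r \<noteq> 0"
  shows "1 \<le> norm r"
proof -
  obtain i where i: "r $ i \<noteq> 0" using \<open>r \<noteq> 0\<close> by (auto simp: vec_eq_iff)
  then have "1 \<le> \<bar>r $ i\<bar>"
    using assms(1) Ints_nonzero_abs_ge1 by (auto simp: int_lattice_def)
  also have "\<dots> \<le> norm r" by (rule component_le_norm_cart)
  finally show ?thesis .
qed

definition cotan_lattice :: "('d::finite) cotan set" where
  "cotan_lattice = int_lattice \<times> {0}"

lemma cotan_proj_eq_iff: "cotan_proj z = cotan_proj w \<longleftrightarrow> z - w \<in> cotan_lattice"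
  by (cases z; cases w) (auto simp: cotan_proj_def cotan_lattice_def torus_proj_eq_iff)

lemma cotan_lattice_diff:
  "r \<in> cotan_lattice \<Longrightarrow> s \<in> cotan_lattice \<Longrightarrow> r - s \<in> cotan_lattice"
  by (auto simp: cotan_lattice_def int_lattice_diff)

lemma cotan_lattice_norm_ge_1: "r \<in> cotan_lattice \<Longrightarrow> r \<noteq> 0 \<Longrightarrow> 1 \<le> norm r"
  by (auto simp: cotan_lattice_def norm_Pair zero_prod_def intro!: int_lattice_norm_ge_1)

lemma cotan_proj_surj: "\<exists>a. cotan_proj a = b"
proof -
  have "torus_proj (rep_torus (fst b)) = fst b"
    by (rule Quotient_abs_rep[OF Quotient_torus])
  then show ?thesis
    by (intro exI[of _ "(rep_torus (fst b), snd b)"]) (simp add: cotan_proj_def prod_eq_iff)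
qed

text \<open>Two lifts of the same map differ by a function with values in a discrete group. By continuity it is
  locally constant, so the lifts have the same derivative.\<close>

lemma continuous_discrete_eventually_const:
  fixes h :: "'a::real_normed_vector \<Rightarrow> 'c::real_normed_vector"
  assumes "isCont h a" and \<Lambda>: "\<forall>\<^sub>F u in nhds a. h u \<in> \<Lambda>"
    and diff: "\<And>r s. r \<in> \<Lambda> \<Longrightarrow> s \<in> \<Lambda> \<Longrightarrow> r - s \<in> \<Lambda>"
    and discrete: "\<And>r. r \<in> \<Lambda> \<Longrightarrow> r \<noteq> 0 \<Longrightarrow> 1 \<le> norm r"
  shows "\<forall>\<^sub>F u in at a. h u = h a"
proof -
  have "(h \<longlongrightarrow> h a) (at a)" using \<open>isCont h a\<close> by (simp add: isCont_def)
  then have "\<forall>\<^sub>F u in at a. dist (h u) (h a) < 1" by (rule tendstoD) simp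
  moreover have "\<forall>\<^sub>F u in at a. h u \<in> \<Lambda>"
    using \<Lambda> unfolding eventually_nhds_conv_at by blast
  ultimately show ?thesis
  proof eventually_elim
    case (elim u)
    show ?case
    proof (rule ccontr)
      assume "h u \<noteq> h a"
      then have "1 \<le> norm (h u - h a)"
        using discrete diff elim eventually_nhds_x_imp_x[OF \<Lambda>] by auto
      then show False using elim by (simp add: dist_norm)
    qed
  qed
qed

lemma lifts_same_derivative:
  fixes g g' :: "'a::real_normed_vector \<Rightarrow> 'c::real_normed_vector"
  assumes g: "(g has_derivative L) (at a)" "(g' has_derivative L') (at a)"
    and eq: "\<forall>\<^sub>F u in nhds a. g u - g' u \<in> \<Lambda>"
    and diff: "\<And>r s. r \<in> \<Lambda> \<Longrightarrow> s \<in> \<Lambda> \<Longrightarrow> r - s \<in> \<Lambda>"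
    and discrete: "\<And>r. r \<in> \<Lambda> \<Longrightarrow> r \<noteq> 0 \<Longrightarrow> 1 \<le> norm r"
  shows "L = L'"
proof -
  have h: "((\<lambda>u. g u - g' u) has_derivative (\<lambda>v. L v - L' v)) (at a)"
    by (intro has_derivative_diff g)
  then have "\<forall>\<^sub>F u in at a. g u - g' u = g a - g' a"
    using continuous_discrete_eventually_const[OF has_derivative_continuous[OF h] eq diff discrete]
    by blast
  then have "((\<lambda>u. g a - g' a) has_derivative (\<lambda>v. L v - L' v)) (at a)"
    using has_derivative_transform_eventually[OF h] by simp
  from has_derivative_unique[OF this has_derivative_const] show ?thesis
    by (simp add: fun_eq_iff)
qed

text \<open>The lift \<open>a\<close> of the base point is what makes the differential unique: over a point outside the
  range of the covering, every linear map would be a differential.\<close>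

lemma differential_eqI:
  assumes D: "has_differential q\<^sub>1 q\<^sub>2 G L b" and a: "q\<^sub>1 a = b"
    and lattice: "\<And>y y'. q\<^sub>2 y = q\<^sub>2 y' \<Longrightarrow> y - y' \<in> \<Lambda>"
    and diff: "\<And>r s. r \<in> \<Lambda> \<Longrightarrow> s \<in> \<Lambda> \<Longrightarrow> r - s \<in> \<Lambda>"
    and discrete: "\<And>r. r \<in> \<Lambda> \<Longrightarrow> r \<noteq> 0 \<Longrightarrow> 1 \<le> norm r"
  shows "differential q\<^sub>1 q\<^sub>2 G b = L"
  unfolding differential_def
proof (rule the_equality[where P = "\<lambda>L. has_differential q\<^sub>1 q\<^sub>2 G L b"])
  show "has_differential q\<^sub>1 q\<^sub>2 G L b" by (rule D)
  fix L' assume "has_differential q\<^sub>1 q\<^sub>2 G L' b"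
  then obtain g' where g': "\<forall>\<^sub>F u in nhds a. q\<^sub>2 (g' u) = G (q\<^sub>1 u)" "(g' has_derivative L') (at a)"
    using a unfolding has_differential_def by blast
  obtain g where g: "\<forall>\<^sub>F u in nhds a. q\<^sub>2 (g u) = G (q\<^sub>1 u)" "(g has_derivative L) (at a)"
    using D a unfolding has_differential_def by blast
  have "\<forall>\<^sub>F u in nhds a. g' u - g u \<in> \<Lambda>"
    using g(1) g'(1) by eventually_elim (auto intro: lattice)
  then show "L' = L"
    by (rule lifts_same_derivative[OF g'(2) g(2) _ diff discrete])
qed

lemma vertical_eq: "vertical b = {v. fst v = 0}"
proof -
  obtain a where a: "cotan_proj a = b" using cotan_proj_surj by blast
  have "has_differential cotan_proj torus_proj fst fst b"
    unfolding has_differential_def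
    by (intro allI impI exI[of _ fst] conjI bounded_linear_imp_has_derivative[OF bounded_linear_fst])
      (simp add: cotan_proj_def)
  then have "differential cotan_proj torus_proj fst b = fst"
    by (rule differential_eqI[where a = a and \<Lambda> = int_lattice])
      (simp_all add: a torus_proj_eq_iff int_lattice_diff int_lattice_norm_ge_1)
  then show ?thesis by (simp add: vertical_def)
qed

lemma int_iterate_int: "int_iterate F (int n) = F ^^ n"
  by (simp add: int_iterate_def)

section \<open>Covectors as vectors\<close>

definition riesz :: "('d::finite) dual \<Rightarrow> real^'d" where
  "riesz p = (\<Sum>b\<in>Basis. blinfun_apply p b *\<^sub>R b)"

lemma basis_functional_inner:
  fixes l :: "'a::euclidean_space \<Rightarrow> real"
  assumes "bounded_linear l"
  shows "(\<Sum>b\<in>Basis. l b *\<^sub>R b) \<bullet> v = l v"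
proof -
  interpret bounded_linear l by (rule assms)
  have "l v = l (\<Sum>b\<in>Basis. (v \<bullet> b) *\<^sub>R b)" by (simp only: euclidean_representation)
  also have "\<dots> = (\<Sum>b\<in>Basis. (v \<bullet> b) * l b)" by (simp add: sum scale)
  also have "\<dots> = (\<Sum>b\<in>Basis. l b *\<^sub>R b) \<bullet> v"
    by (simp add: inner_sum_left inner_commute[of v] mult.commute)
  finally show ?thesis by simp
qed

lemma riesz_inner: "riesz p \<bullet> v = blinfun_apply p v"
  unfolding riesz_def by (rule basis_functional_inner[OF blinfun.bounded_linear_right])

lemma blinfun_inner_right_riesz: "blinfun_inner_right (riesz p) = p"
  by (rule blinfun_eqI) (simp add: riesz_inner)

lemma riesz_blinfun_inner_right: "riesz (blinfun_inner_right v) = v"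
  by (rule vector_eq_rdot[THEN iffD1]) (simp add: riesz_inner)

lemma bounded_linear_riesz: "bounded_linear riesz"
  unfolding riesz_def
  by (intro bounded_linear_sum bounded_linear_scaleR_const blinfun.bounded_linear_left)

definition to_vec :: "('d::finite) cotan \<Rightarrow> (real^'d) \<times> (real^'d)" where
  "to_vec z = (fst z, riesz (snd z))"

definition of_vec :: "(real^'d) \<times> (real^'d) \<Rightarrow> ('d::finite) cotan" where
  "of_vec w = (fst w, blinfun_inner_right (snd w))"

lemma of_vec_to_vec [simp]: "of_vec (to_vec z) = z"
  by (simp add: of_vec_def to_vec_def blinfun_inner_right_riesz)

lemma to_vec_of_vec [simp]: "to_vec (of_vec w) = w"
  by (simp add: of_vec_def to_vec_def riesz_blinfun_inner_right)

lemma bounded_linear_to_vec: "bounded_linear to_vec"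
  unfolding to_vec_def
  by (intro bounded_linear_Pair bounded_linear_fst
      bounded_linear_compose[OF bounded_linear_riesz bounded_linear_snd])

lemma bounded_linear_of_vec: "bounded_linear of_vec"
  unfolding of_vec_def
  by (intro bounded_linear_Pair bounded_linear_fst
      bounded_linear_compose[OF bounded_linear_blinfun_inner_right bounded_linear_snd])

lemma conjugate_iterate:
  fixes f :: "('d::finite) cotan \<Rightarrow> 'd cotan"
  shows "((\<lambda>w. to_vec (f (of_vec w))) ^^ n) w = to_vec ((f ^^ n) (of_vec w))"
  by (induction n) auto

lemma int_lattice_cocompact: "\<exists>r\<in>int_lattice. x - r \<in> cbox 0 (\<chi> i. (1 :: real))"
proof
  show "(\<chi> i. of_int \<lfloor>x $ i\<rfloor>) \<in> int_lattice" by (simp add: int_lattice_def)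
  show "x - (\<chi> i. of_int \<lfloor>x $ i\<rfloor>) \<in> cbox 0 (\<chi> i. 1)"
    unfolding mem_box_cart by (auto simp: less_imp_le frac_lt_1 simp flip: frac_def)
qed

section \<open>Twist maps of the torus\<close>

text \<open>The Hessian \<open>S''\<close> on the product space contains all the data: its values on \<open>(\<xi>, 0)\<close> and
  \<open>(0, \<xi>)\<close> give the quadratic form of the mixed partial derivatives.\<close>

lemma generating_function_twist:
  fixes S :: "real^'d \<Rightarrow> real^'d \<Rightarrow> real" and f :: "('d::finite) cotan \<Rightarrow> 'd cotan"
  assumes S: "generating_function S" and f: "generates S f"
  obtains s1 s2 s1' s2' A where
    "generated_twist (\<lambda>(x, y). S x y) s1 s2 s1' s2' (\<lambda>w. to_vec (f (of_vec w)))
      int_lattice (cbox 0 (\<chi> i. 1)) A"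
proof -
  obtain S' and S'' :: "(real^'d) \<times> (real^'d) \<Rightarrow>
      ((real^'d) \<times> (real^'d)) \<Rightarrow>\<^sub>L ((real^'d) \<times> (real^'d)) \<Rightarrow>\<^sub>L real"
    where S': "\<And>z. ((\<lambda>(x, y). S x y) has_derivative blinfun_apply (S' z)) (at z)"
      and S'': "\<And>z. (S' has_derivative blinfun_apply (S'' z)) (at z)"
      and cont: "continuous_on UNIV S''"
    using S unfolding generating_function_def C2_def by blast
  obtain A where A: "A > 0" "\<And>x y \<xi>.
      (\<Sum>i\<in>UNIV. \<Sum>j\<in>UNIV. mixed_partial i j S x y * \<xi> $ i * \<xi> $ j) \<le> - A * (norm \<xi>)\<^sup>2"
    using S unfolding generating_function_def by blast
  have per: "S (x + r) (y + r) = S x y" if "r \<in> int_lattice" for x y r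
    using S that unfolding generating_function_def by blast
  define T1 where "T1 q = (\<Sum>b\<in>Basis. blinfun_apply q (b, 0) *\<^sub>R b)"
    for q :: "((real^'d) \<times> (real^'d)) \<Rightarrow>\<^sub>L real"
  define T2 where "T2 q = (\<Sum>b\<in>Basis. blinfun_apply q (0, b) *\<^sub>R b)"
    for q :: "((real^'d) \<times> (real^'d)) \<Rightarrow>\<^sub>L real"
  have T: "bounded_linear T1" "bounded_linear T2"
    unfolding T1_def T2_def
    by (intro bounded_linear_sum bounded_linear_scaleR_const blinfun.bounded_linear_left)+
  have bl1: "bounded_linear (\<lambda>\<xi>. blinfun_apply q (\<xi>, 0))"
    and bl2: "bounded_linear (\<lambda>\<xi>. blinfun_apply q (0, \<xi>))"
    for q :: "((real^'d) \<times> (real^'d)) \<Rightarrow>\<^sub>L real"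
    by (intro bounded_linear_compose[OF blinfun.bounded_linear_right] bounded_linear_Pair
        bounded_linear_ident bounded_linear_zero)+
  have T1_inner: "T1 q \<bullet> \<xi> = blinfun_apply q (\<xi>, 0)"
    and T2_inner: "T2 q \<bullet> \<xi> = blinfun_apply q (0, \<xi>)" for q \<xi>
    unfolding T1_def T2_def by (rule basis_functional_inner[OF bl1], rule basis_functional_inner[OF bl2])
  have "continuous_on UNIV (\<lambda>p. blinfun_apply (S'' (fst p)) (snd p))"
    by (intro blinfun.continuous_on continuous_on_compose2[OF cont] continuous_intros) auto
  then have C1_S': "C1 S' (\<lambda>z. blinfun_apply (S'' z))"
    using S'' by (simp add: C1_def split_beta)
  have partial1: "((\<lambda>u. S u y) has_derivative (\<lambda>\<xi>. blinfun_apply (S' (x, y)) (\<xi>, 0))) (at x)" for x y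
  proof -
    have "((\<lambda>u. (u, y)) has_derivative (\<lambda>\<xi>. (\<xi>, 0))) (at x)"
      by (auto intro!: derivative_eq_intros)
    from has_derivative_compose[OF this S'] show ?thesis by simp
  qed
  have partial2: "((\<lambda>v. S x v) has_derivative (\<lambda>\<xi>. blinfun_apply (S' (x, y)) (0, \<xi>))) (at y)" for x y
  proof -
    have "((\<lambda>v. (x, v)) has_derivative (\<lambda>\<xi>. (0, \<xi>))) (at y)"
      by (auto intro!: derivative_eq_intros)
    from has_derivative_compose[OF this S'] show ?thesis by simp
  qed
  have D1: "riesz (D1 S x y) = T1 (S' (x, y))" for x y
    unfolding D1_def frechet_derivative_at[OF partial1, symmetric] riesz_def T1_def
    by (simp add: bounded_linear_Blinfun_apply[OF bl1])
  have D2: "riesz (D2 S x y) = T2 (S' (x, y))" for x y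
    unfolding D2_def frechet_derivative_at[OF partial2, symmetric] riesz_def T2_def
    by (simp add: bounded_linear_Blinfun_apply[OF bl2])
  have mixed: "mixed_partial i j S x y = blinfun_apply (blinfun_apply (S'' (x, y)) (axis i 1, 0)) (0, axis j 1)"
    for i j x y
  proof -
    have "(\<lambda>u. partial_deriv j (S u) y) = (\<lambda>u. blinfun_apply (S' (u, y)) (0, axis j 1))"
      unfolding partial_deriv_def frechet_derivative_at[OF partial2, symmetric] ..
    moreover have "((\<lambda>u. blinfun_apply (S' (u, y)) (0, axis j 1)) has_derivative
        (\<lambda>\<xi>. blinfun_apply (blinfun_apply (S'' (x, y)) (\<xi>, 0)) (0, axis j 1))) (at x)"
    proof -
      have "((\<lambda>u. (u, y)) has_derivative (\<lambda>\<xi>. (\<xi>, 0))) (at x)"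
        by (auto intro!: derivative_eq_intros)
      from has_derivative_compose[OF this S'']
      have "((\<lambda>u. S' (u, y)) has_derivative (\<lambda>\<xi>. blinfun_apply (S'' (x, y)) (\<xi>, 0))) (at x)" .
      then show ?thesis
        by (rule bounded_linear.has_derivative[OF blinfun.bounded_linear_left])
    qed
    ultimately show ?thesis
      unfolding mixed_partial_def partial_deriv_def[of i] by (simp flip: frechet_derivative_at)
  qed
  have twist: "blinfun_apply (blinfun_apply (S'' (x, y)) (\<xi>, 0)) (0, \<xi>) \<le> - A * (norm \<xi>)\<^sup>2" for x y \<xi>
  proof -
    have expand: "(\<Sum>i\<in>UNIV. \<xi> $ i *\<^sub>R axis i 1) = \<xi>"
      using basis_expansion[of \<xi>] by (simp add: scalar_mult_eq_scaleR)
    have pairs: "(\<Sum>i\<in>UNIV. \<xi> $ i *\<^sub>R (axis i 1, 0)) = (\<xi>, 0 :: real^'d)"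
      "(\<Sum>i\<in>UNIV. \<xi> $ i *\<^sub>R (0, axis i 1)) = (0 :: real^'d, \<xi>)"
      by (simp_all add: prod_eq_iff fst_sum snd_sum expand)
    have "blinfun_apply (blinfun_apply (S'' (x, y)) (\<xi>, 0)) (0, \<xi>)
        = blinfun_apply (blinfun_apply (S'' (x, y)) (\<Sum>i\<in>UNIV. \<xi> $ i *\<^sub>R (axis i 1, 0))) (\<Sum>j\<in>UNIV. \<xi> $ j *\<^sub>R (0, axis j 1))"
      by (simp only: pairs)
    also have "\<dots> = (\<Sum>i\<in>UNIV. \<Sum>j\<in>UNIV. mixed_partial i j S x y * \<xi> $ i * \<xi> $ j)"
      unfolding mixed
      by (simp add: blinfun.sum_left blinfun.sum_right blinfun.scaleR_left blinfun.scaleR_right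
          sum_distrib_left mult_ac del: scaleR_Pair)
        (subst sum.swap, simp add: mult_ac)
    finally show ?thesis using A(2) by simp
  qed
  show ?thesis
  proof (rule that, unfold_locales)
    show "((\<lambda>(x, y). S x y) has_derivative
        (\<lambda>\<zeta>. T1 (S' z) \<bullet> fst \<zeta> + T2 (S' z) \<bullet> snd \<zeta>)) (at z)" for z
      using S'[of z] by (simp add: T1_inner T2_inner flip: blinfun.add_right)
    show "C1 (\<lambda>z. T1 (S' z)) (\<lambda>z v. T1 (blinfun_apply (S'' z) v))"
      "C1 (\<lambda>z. T2 (S' z)) (\<lambda>z v. T2 (blinfun_apply (S'' z) v))"
      by (intro C1_compose[OF C1_S'] C1_bounded_linear T)+
    show "T2 (blinfun_apply (S'' z) (\<xi>, 0)) \<bullet> \<xi> \<le> - A * (norm \<xi>)\<^sup>2" for z \<xi>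
      using twist[of "fst z" "snd z"] by (simp add: T2_inner)
    show "(to_vec (f (of_vec (x, p))) = (x', p')) =
        (p = - T1 (S' (x, x')) \<and> p' = T2 (S' (x, x')))" for x p x' p'
    proof -
      have "to_vec (f (of_vec (x, p))) = (x', p') \<longleftrightarrow> f (of_vec (x, p)) = of_vec (x', p')"
        by (metis of_vec_to_vec to_vec_of_vec)
      also have "\<dots> \<longleftrightarrow> blinfun_inner_right p = - D1 S x x' \<and> blinfun_inner_right p' = D2 S x x'"
        using f by (simp add: of_vec_def generates_def)
      also have "\<dots> \<longleftrightarrow> p = riesz (- D1 S x x') \<and> p' = riesz (D2 S x x')"
        by (metis riesz_blinfun_inner_right blinfun_inner_right_riesz)
      also have "riesz (- D1 S x x') = - riesz (D1 S x x')"
        using linear_simps(4)[OF bounded_linear_riesz] by blast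
      finally show ?thesis by (simp add: D1 D2)
    qed
  qed (use A per int_lattice_cocompact in auto)
qed

theorem theorem1:
  fixes F :: "('d::finite) cotan_torus \<Rightarrow> 'd cotan_torus"
    and Fbar :: "'d cotan \<Rightarrow> 'd cotan"
    and N :: nat and r x :: "real^'d"
  assumes "twist_map F"
    and "without_conjugate_points F"
    and "is_lift F Fbar"
    and "N \<ge> 1"
    and "r \<in> int_lattice"
  shows "\<exists>!p. (Fbar ^^ N) (x, p) = (x + r, p)"
proof -
  obtain S f where S: "generating_function S" "generates S f"
    and lift: "\<And>z. F (cotan_proj z) = cotan_proj (f z)"
    using \<open>twist_map F\<close> unfolding twist_map_def by blast
  define \<phi> where "\<phi> w = to_vec (f (of_vec w))" for w
  obtain s1 s2 s1' s2' A where
    "generated_twist (\<lambda>(x, y). S x y) s1 s2 s1' s2' \<phi> int_lattice (cbox 0 (\<chi> i. 1)) A"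
    using generating_function_twist[OF S] unfolding \<phi>_def by blast
  then interpret generated_twist "\<lambda>(x, y). S x y" s1 s2 s1' s2' \<phi> int_lattice "cbox 0 (\<chi> i. 1)" A .
  have f_iter: "(f ^^ n) z = of_vec ((\<phi> ^^ n) (to_vec z))" for n z
    unfolding \<phi>_def conjugate_iterate by simp
  have f_translate: "(f ^^ n) (z + (s, 0)) = (f ^^ n) z + (s, 0)" if "s \<in> int_lattice" for n z s
    using iterate_translate[OF that, of n "fst z" "riesz (snd z)"]
    by (simp add: f_iter to_vec_def of_vec_def iterate_eq)
  have lift_iter: "(F ^^ n) (cotan_proj z) = cotan_proj ((f ^^ n) z)" for n z
    by (induction n) (simp_all add: lift)
  have differential_iter: "differential cotan_proj cotan_proj (int_iterate F (int n)) (cotan_proj a) = D"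
    if D: "((f ^^ n) has_derivative D) (at a)" for n a D
  proof (rule differential_eqI[where a = a and \<Lambda> = cotan_lattice])
    show "has_differential cotan_proj cotan_proj (int_iterate F (int n)) D (cotan_proj a)"
      unfolding has_differential_def
    proof (intro allI impI exI[of _ "f ^^ n"] conjI)
      show "\<forall>\<^sub>F u in nhds a'. cotan_proj ((f ^^ n) u) = int_iterate F (int n) (cotan_proj u)" for a'
        by (simp add: int_iterate_int lift_iter)
      fix a' assume "cotan_proj a' = cotan_proj a"
      then obtain s where s: "s \<in> int_lattice" "a' = a + (s, 0)"
        by (cases a; cases a') (auto simp: cotan_proj_eq_iff cotan_lattice_def algebra_simps)
      have shift: "((\<lambda>u. u - (s, 0)) has_derivative (\<lambda>v. v)) (at a')"
        by (auto intro!: derivative_eq_intros)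
      have "(f ^^ n has_derivative D) (at (a' - (s, 0)))" using D s(2) by simp
      from has_derivative_compose[OF shift this]
      have "((\<lambda>u. (f ^^ n) (u - (s, 0)) + (s, 0)) has_derivative D) (at a')"
        by (auto intro!: derivative_eq_intros)
      moreover have "(\<lambda>u. (f ^^ n) (u - (s, 0)) + (s, 0)) = f ^^ n"
        unfolding f_translate[OF s(1), symmetric] by simp
      ultimately show "(f ^^ n has_derivative D) (at a')"
        by simp
    qed
  qed (auto simp: cotan_proj_eq_iff cotan_lattice_diff cotan_lattice_norm_ge_1)
  interpret twist_without_conjugate_points "\<lambda>(x, y). S x y" s1 s2 s1' s2' \<phi> int_lattice "cbox 0 (\<chi> i. 1)" A
  proof
    fix n :: nat and D z and \<eta> :: "real^'d"
    assume n: "n \<ge> 1" and D: "(\<phi> ^^ n has_derivative D) (at z)" and vert: "fst (D (0, \<eta>)) = 0"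
    define a where "a = of_vec z"
    define E where "E v = of_vec (D (to_vec v))" for v
    have "((\<lambda>z. of_vec ((\<phi> ^^ n) (to_vec z))) has_derivative E) (at a)"
      unfolding E_def
      by (intro bounded_linear.has_derivative[OF bounded_linear_of_vec]
          has_derivative_compose[OF bounded_linear_imp_has_derivative[OF bounded_linear_to_vec]])
        (simp add: a_def D)
    moreover have "(\<lambda>z. of_vec ((\<phi> ^^ n) (to_vec z))) = f ^^ n"
      by (simp add: fun_eq_iff f_iter)
    ultimately have "differential cotan_proj cotan_proj (int_iterate F (int n)) (cotan_proj a) = E"
      by (intro differential_iter) simp
    then have "{v. fst v = 0} \<inter> E ` {v. fst v = 0} = {0}"
      using \<open>without_conjugate_points F\<close> n unfolding without_conjugate_points_def vertical_eq
      by (metis of_nat_eq_0_iff not_one_le_zero)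
    moreover have "E (of_vec (0, \<eta>)) \<in> E ` {v. fst v = 0}"
      by (rule imageI) (simp add: of_vec_def)
    moreover have "fst (E (of_vec (0, \<eta>))) = 0"
      using vert unfolding E_def to_vec_of_vec by (simp add: of_vec_def)
    ultimately have "E (of_vec (0, \<eta>)) = 0" by blast
    then have "D (0, \<eta>) = 0"
      unfolding E_def using linear_simps(3)[OF bounded_linear_to_vec] by (metis to_vec_of_vec)
    then have "(0, \<eta>) = (0 :: (real^'d) \<times> (real^'d))"
      by (rule iterate_derivative_injective[OF D])
    then show "\<eta> = 0" by (simp add: zero_prod_def)
  qed
  have contf: "continuous_on UNIV f"
  proof -
    obtain \<phi>' where \<phi>': "C1 \<phi> \<phi>'" using f_C1 by blast
    have "continuous_on UNIV (\<lambda>z. of_vec (\<phi> (to_vec z)))"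
      by (intro linear_continuous_on_compose[OF _ bounded_linear.linear[OF bounded_linear_of_vec]]
          bounded_linear.continuous_on[OF bounded_linear_of_vec]
          C1_continuous[OF \<phi>'] linear_continuous_on bounded_linear_to_vec)
    moreover have "(\<lambda>z. of_vec (\<phi> (to_vec z))) = f"
      by (simp add: \<phi>_def)
    ultimately show ?thesis by (simp only:)
  qed
  have contF: "continuous_on UNIV Fbar" and Fbar: "\<And>z. cotan_proj (Fbar z) = F (cotan_proj z)"
    using \<open>is_lift F Fbar\<close> unfolding is_lift_def by auto
  have dlat: "Fbar z - f z \<in> cotan_lattice" for z
    using Fbar lift by (simp flip: cotan_proj_eq_iff)
  define d where "d = Fbar 0 - f 0"
  have d: "Fbar z - f z = d" for z
    unfolding d_def
  proof (rule connected_local_const[where f = "\<lambda>z. Fbar z - f z", OF connected_UNIV])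
    show "\<forall>z\<in>UNIV. \<forall>\<^sub>F w in at z within UNIV. Fbar z - f z = Fbar w - f w"
    proof
      fix z
      have "continuous_on UNIV (\<lambda>z. Fbar z - f z)" by (intro continuous_intros contf contF)
      then have "isCont (\<lambda>z. Fbar z - f z) z"
        by (rule continuous_on_interior) simp
      then have "\<forall>\<^sub>F w in at z. Fbar w - f w = Fbar z - f z"
        by (rule continuous_discrete_eventually_const[where \<Lambda> = cotan_lattice])
          (auto simp: dlat cotan_lattice_diff cotan_lattice_norm_ge_1)
      then show "\<forall>\<^sub>F w in at z within UNIV. Fbar z - f z = Fbar w - f w"
        by eventually_elim simp
    qed
  qed auto
  obtain s where s: "s \<in> int_lattice" "d = (s, 0)"
    using dlat d by (metis cotan_lattice_def mem_Sigma_iff prod.collapse singletonD)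
  have Fbar_eq: "Fbar z = f z + (s, 0)" for z using d[of z] s(2) by (simp add: algebra_simps)
  have ms: "real n *\<^sub>R s \<in> int_lattice" for n
    using s(1) by (simp add: int_lattice_def)
  have Fbar_iter: "(Fbar ^^ n) z = (f ^^ n) z + (real n *\<^sub>R s, 0)" for n z
  proof (induction n)
    case (Suc n)
    then show ?case
      using f_translate[OF ms, of 1 "(f ^^ n) z" n] by (simp add: Fbar_eq algebra_simps)
  qed (simp add: zero_prod_def)
  define r' where "r' = r - real N *\<^sub>R s"
  have "r' \<in> int_lattice" unfolding r'_def using \<open>r \<in> int_lattice\<close> ms by (rule int_lattice_diff)
  then obtain q where q: "(\<phi> ^^ N) (x, q) = (x + r', q)"
    and unique: "\<And>q'. (\<phi> ^^ N) (x, q') = (x + r', q') \<Longrightarrow> q' = q"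
    using unique_periodic_momentum[OF \<open>N \<ge> 1\<close>, of r' x] by blast
  have iff: "(Fbar ^^ N) (x, p) = (x + r, p) \<longleftrightarrow> (\<phi> ^^ N) (x, riesz p) = (x + r', riesz p)" for p
  proof -
    have "(Fbar ^^ N) (x, p) = (x + r, p) \<longleftrightarrow> of_vec ((\<phi> ^^ N) (to_vec (x, p))) = (x + r', p)"
      unfolding Fbar_iter f_iter r'_def by (auto simp: prod_eq_iff algebra_simps)
    also have "\<dots> \<longleftrightarrow> (\<phi> ^^ N) (to_vec (x, p)) = to_vec (x + r', p)"
      by (metis of_vec_to_vec to_vec_of_vec)
    finally show ?thesis by (simp add: to_vec_def)
  qed
  show ?thesis
  proof (rule ex1I)
    show "(Fbar ^^ N) (x, blinfun_inner_right q) = (x + r, blinfun_inner_right q)"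
      unfolding iff riesz_blinfun_inner_right by (rule q)
    show "p = blinfun_inner_right q" if "(Fbar ^^ N) (x, p) = (x + r, p)" for p
      using unique[of "riesz p"] that unfolding iff by (metis blinfun_inner_right_riesz)
  qed
qed

end
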